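(* Let $p$ be a prime and $m\ge 1$ an integer. Let $\{F_\lambda\}_{\lambda\in\Lambda}$ be an $m$-dimensional continued fraction system, and let $T: D_m'\to D_m'$ be the transformation associated with $\{F_\lambda\}_{\lambda\in\Lambda}$. Then the measure $\mu_m$ (restricted to $D_m'$) is an ergodic measure of the transformation $T$.
   Context: For $\alpha\in\mathbb{Q}_p$, $\mathrm{ord}(\alpha)$ is the $p$-adic valuation, with $\mathrm{ord}(0)=\infty$. Let $D_m=\{(x_1,\dots,x_m)\in\mathbb{Q}_p^m : 1,x_1,\dots,x_m \text{ are linearly independent over } \mathbb{Z}\}$ and $D_m'=D_m\cap(p\mathbb{Z}_p)^m$. LFT: Let $i\in\{1,\dots,m\}$, $\sigma$ a permutation of $\{1,\dots,m\}$, $\mathbf{p}=(p_1,\dots,p_m)\in(\mathbb{Q}^\times)^m$, $\mathbf{q}=(q_1,\dots,q_m)\in\mathbb{Q}^m$. The $m$-dimensional linear fractional transformation (LFT) with parameter $(i,\sigma,\mathbf{p},\mathbf{q})$ is the map $F:D_m\to D_m$, $F(x_1,\dots,x_m)=(y_1,\dots,y_m)$, where $y_k=p_k/x_i-q_k$ if $k=\sigma^{-1}(i)$ and $y_k=p_kx_{\sigma(k)}/x_i-q_k$ if $k\neq\sigma^{-1}(i)$. It is a bijection of $D_m$. Hyperbolic: with $s=\sigma^{-1}(i)$, $F$ is hyperbolic if (i) for every $k$, $p_k\ne0$ and $\mathrm{ord}(p_k)\ge0$; (ii) $\mathrm{ord}(q_s)\le0$ and $\mathrm{ord}(p_s/q_s)>0$;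 (iii) if $k\ne s$ and $\mathrm{ord}(q_k)\le0$, then $\mathrm{ord}(p_s/q_s)-\mathrm{ord}(p_k/q_k)>0$; (iv) if $k\ne s$ and $\mathrm{ord}(q_k)>0$, then $\mathrm{ord}(p_s/q_s)-\mathrm{ord}(p_k)>0$. Continued fraction system: a family $\{F_\lambda\}_{\lambda\in\Lambda}$ of hyperbolic $m$-dimensional LFTs, $\Lambda$ countable, such that $\{F_\lambda^{-1}(D_m')\}_{\lambda\in\Lambda}$ is a partition of $D_m'$ (i.e. $D_m'$ is the disjoint union of these sets over $\lambda\in\Lambda$). The associated transformation is $T:D_m'\to D_m'$, $T(\alpha)=F_\lambda(\alpha)$ if $\alpha\in F_\lambda^{-1}(D_m')$. $\mu$ is the Haar measure on $(\mathbb{Q}_p,+)$ normalized by $\mu(pa+p^n\mathbb{Z}_p)=p^{-(n-1)}$ (so $\mu(p\mathbb{Z}_p)=1$), and $\mu_m=\mu^m$ is the product measure on $(p\mathbb{Z}_p)^m$; $D_m'$ has full $\mu_m$-measure in $(p\mathbb{Z}_p)^m$. A set $X\subset D_m'$ is $T$-invariant if it is measurable and $X=T^{-1}(X)$. An ergodic measure of $T$ is a $T$-invariant probability measure for which every $T$-invariant set has measure $0$ or $1$. *)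

theory Defs
  imports "HOL-Probability.Probability"
begin

text \<open>A prime $p$ is represented by a type with $p$ elements.\<close>

class prime_card = finite +
  assumes prime_card: "prime CARD('a)"

instance bool :: prime_card
  by standard (simp add: two_is_prime_nat)

section \<open>The valuation on the rationals\<close>

definition rat_ord :: "nat \<Rightarrow> rat \<Rightarrow> ereal" where
  "rat_ord p x = (if x = 0 then \<infinity> else
     ereal (real (multiplicity (int p) (fst (quotient_of x)))
          - real (multiplicity (int p) (snd (quotient_of x)))))"

lemma rat_ord_0 [simp]: "rat_ord p 0 = \<infinity>"
  by (simp add: rat_ord_def)

lemma rat_ord_eq_infinity_iff [simp]: "rat_ord p x = \<infinity> \<longleftrightarrow> x = 0"
  by (simp add: rat_ord_def)

lemma rat_ord_1 [simp]: "rat_ord p 1 = 0"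
  by (simp add: rat_ord_def zero_ereal_def)

lemma rat_as_quotient:
  fixes x :: rat
  obtains a b :: int where "x = of_int a / of_int b" "b \<noteq> 0"
proof (cases "quotient_of x")
  case (Pair a b)
  show ?thesis using that[of a b] quotient_of_div[OF Pair] quotient_of_denom_pos[OF Pair] by simp
qed

context
  fixes p :: nat
  assumes p: "prime p"
begin

lemma prime_elem_p: "prime_elem (int p)"
  using p by simp

lemma not_unit_p: "\<not> is_unit (int p)"
  using prime_elem_p by (rule prime_elem_not_unit)

lemma rat_ord_quotient:
  fixes a b :: int
  assumes "a \<noteq> 0" "b \<noteq> 0"
  shows "rat_ord p (of_int a / of_int b) =
    ereal (real (multiplicity (int p) a) - real (multiplicity (int p) b))"
proof -
  define c where "c = fst (quotient_of (of_int a / of_int b))"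
  define d where "d = snd (quotient_of (of_int a / of_int b))"
  have q: "quotient_of (of_int a / of_int b) = (c, d)" by (simp add: c_def d_def)
  have d: "d > 0" using quotient_of_denom_pos[OF q] .
  have eq: "of_int a / of_int b = (of_int c / of_int d :: rat)"
    using quotient_of_div[OF q] .
  hence "of_int (a * d) = (of_int (c * b) :: rat)" using assms d by (simp add: field_simps)
  hence ad: "a * d = c * b" by (simp only: of_int_eq_iff)
  hence c: "c \<noteq> 0" using assms d by auto
  have "multiplicity (int p) a + multiplicity (int p) d = multiplicity (int p) c + multiplicity (int p) b"
    using prime_elem_multiplicity_mult_distrib[OF prime_elem_p] ad assms d c by (metis less_numeral_extra(3))
  thus ?thesis using assms by (simp add: rat_ord_def flip: c_def d_def)
qed

lemma rat_ord_mult: "rat_ord p (x * y) = rat_ord p x + rat_ord p y"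
proof (cases "x = 0 \<or> y = 0")
  case False
  obtain a b where x: "x = of_int a / of_int b" "b \<noteq> 0" by (rule rat_as_quotient)
  obtain c d where y: "y = of_int c / of_int d" "d \<noteq> 0" by (rule rat_as_quotient)
  have nz: "a \<noteq> 0" "c \<noteq> 0" using False x y by auto
  have "x * y = of_int (a * c) / of_int (b * d)" using x y by simp
  thus ?thesis using x y nz
    by (simp add: rat_ord_quotient prime_elem_multiplicity_mult_distrib[OF prime_elem_p]
        del: of_int_mult)
qed (auto simp: rat_ord_def)

lemma rat_ord_minus [simp]: "rat_ord p (- x) = rat_ord p x"
proof (cases "x = 0")
  case False
  obtain a b where x: "x = of_int a / of_int b" "b \<noteq> 0" by (rule rat_as_quotient)
  hence "a \<noteq> 0" "- x = of_int (- a) / of_int b" using False by auto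
  moreover have "multiplicity (int p) (- a) = multiplicity (int p) a"
    using multiplicity_times_unit_right[of "-1::int" "int p" a] by simp
  ultimately show ?thesis
    using x rat_ord_quotient[of "- a" b] rat_ord_quotient[of a b] by simp
qed simp

lemma rat_ord_add: "min (rat_ord p x) (rat_ord p y) \<le> rat_ord p (x + y)"
proof (cases "x = 0 \<or> y = 0 \<or> x + y = 0")
  case False
  obtain a b where x: "x = of_int a / of_int b" "b \<noteq> 0" by (rule rat_as_quotient)
  obtain c d where y: "y = of_int c / of_int d" "d \<noteq> 0" by (rule rat_as_quotient)
  let ?m = "multiplicity (int p)"
  have nz: "a \<noteq> 0" "c \<noteq> 0" using False x y by auto
  have xy: "x + y = of_int (a * d + c * b) / of_int (b * d)" using x y by (simp add: field_simps)
  have nz': "a * d + c * b \<noteq> 0" using False xy by (metis div_0 of_int_0)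
  define k where "k = min (?m (a * d)) (?m (c * b))"
  have "int p ^ k dvd a * d" "int p ^ k dvd c * b"
    by (simp_all add: multiplicity_dvd' k_def)
  hence "int p ^ k dvd a * d + c * b" by (rule dvd_add)
  hence k: "k \<le> ?m (a * d + c * b)"
    using power_dvd_iff_le_multiplicity[OF nz' not_unit_p] by simp
  have m: "?m (a * d) = ?m a + ?m d" "?m (c * b) = ?m c + ?m b" "?m (b * d) = ?m b + ?m d"
    using nz x y by (simp_all add: prime_elem_multiplicity_mult_distrib[OF prime_elem_p])
  have "rat_ord p (x + y) = ereal (real (?m (a * d + c * b)) - real (?m (b * d)))"
    unfolding xy using nz' x y by (simp add: rat_ord_quotient del: of_int_mult of_int_add)
  moreover have "rat_ord p x = ereal (real (?m a) - real (?m b))" "rat_ord p y = ereal (real (?m c) - real (?m d))"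
    using x y nz by (simp_all add: rat_ord_quotient)
  ultimately show ?thesis using k unfolding k_def m by (auto simp: min_def)
qed auto

lemma rat_ord_add_ge: "K \<le> rat_ord p x \<Longrightarrow> K \<le> rat_ord p y \<Longrightarrow> K \<le> rat_ord p (x + y)"
  by (rule order_trans[OF _ rat_ord_add]) simp

lemma rat_ord_diff_ge: "K \<le> rat_ord p x \<Longrightarrow> K \<le> rat_ord p y \<Longrightarrow> K \<le> rat_ord p (x - y)"
  using rat_ord_add_ge[of K x "- y"] by simp

lemma rat_ord_minus_commute: "rat_ord p (x - y) = rat_ord p (y - x)"
  using rat_ord_minus[of "x - y"] by simp

lemma rat_ord_mult_ge:
  "ereal K \<le> rat_ord p x \<Longrightarrow> ereal L \<le> rat_ord p y \<Longrightarrow> ereal (K + L) \<le> rat_ord p (x * y)"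
  unfolding rat_ord_mult plus_ereal.simps(1)[symmetric] by (rule add_mono)

lemma rat_ord_eqI: "rat_ord p x < rat_ord p (x - y) \<Longrightarrow> rat_ord p y = rat_ord p x"
  using rat_ord_diff_ge[of "rat_ord p x" x "x - y"] rat_ord_add[of "x - y" y]
  by (auto simp: min_def split: if_splits)

lemma rat_ord_inverse_diff:
  assumes "x \<noteq> 0" "y \<noteq> 0" "rat_ord p x = ereal c" "rat_ord p y = ereal c"
  shows "rat_ord p (inverse x - inverse y) = rat_ord p (x - y) - ereal (2 * c)"
proof -
  have "x - y = (inverse y - inverse x) * (x * y)" using assms by (simp add: field_simps)
  hence "rat_ord p (x - y) = rat_ord p (inverse y - inverse x) + ereal (2 * c)"
    using assms by (simp only: rat_ord_mult) simp
  thus ?thesis unfolding rat_ord_minus_commute[of "inverse x"]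
    by (cases "rat_ord p (inverse y - inverse x)") auto
qed

end


section \<open>The field of $p$-adic numbers\<close>

text \<open>Cauchy sequences and null sequences of rationals for the $p$-adic absolute value
  $|x|_p = p^{-\mathrm{ord}(x)}$.\<close>

definition padic_cauchy :: "nat \<Rightarrow> (nat \<Rightarrow> rat) \<Rightarrow> bool" where
  "padic_cauchy p X \<longleftrightarrow> (\<forall>K::real. \<exists>N. \<forall>i\<ge>N. \<forall>j\<ge>N. ereal K \<le> rat_ord p (X i - X j))"

definition padic_null :: "nat \<Rightarrow> (nat \<Rightarrow> rat) \<Rightarrow> bool" where
  "padic_null p X \<longleftrightarrow> (\<lambda>n. rat_ord p (X n)) \<longlonglongrightarrow> \<infinity>"

definition padic_rel :: "nat \<Rightarrow> (nat \<Rightarrow> rat) \<Rightarrow> (nat \<Rightarrow> rat) \<Rightarrow> bool" where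
  "padic_rel p X Y \<longleftrightarrow> padic_cauchy p X \<and> padic_cauchy p Y \<and> padic_null p (\<lambda>n. X n - Y n)"

lemma padic_null_iff: "padic_null p X \<longleftrightarrow> (\<forall>K::real. \<exists>N. \<forall>n\<ge>N. ereal K \<le> rat_ord p (X n))"
  unfolding padic_null_def Lim_PInfty ..

lemma padic_cauchy_const: "padic_cauchy p (\<lambda>_. x)"
  by (simp add: padic_cauchy_def)

lemma padic_null_zero: "padic_null p (\<lambda>_. 0)"
  by (simp add: padic_null_def)

context
  fixes p :: nat
  assumes p: "prime p"
begin

lemma padic_cauchy_add:
  assumes "padic_cauchy p X" "padic_cauchy p Y"
  shows "padic_cauchy p (\<lambda>n. X n + Y n)"
  unfolding padic_cauchy_def
proof
  fix K :: real
  obtain N M where N: "\<forall>i\<ge>N. \<forall>j\<ge>N. ereal K \<le> rat_ord p (X i - X j)"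
    and M: "\<forall>i\<ge>M. \<forall>j\<ge>M. ereal K \<le> rat_ord p (Y i - Y j)"
    using assms unfolding padic_cauchy_def by meson
  have "ereal K \<le> rat_ord p (X i + Y i - (X j + Y j))" if "i \<ge> max N M" "j \<ge> max N M" for i j
    using rat_ord_add_ge[OF p, of "ereal K" "X i - X j" "Y i - Y j"] N M that
    by (simp add: algebra_simps)
  thus "\<exists>N. \<forall>i\<ge>N. \<forall>j\<ge>N. ereal K \<le> rat_ord p (X i + Y i - (X j + Y j))" by blast
qed

lemma padic_cauchy_minus: "padic_cauchy p X \<Longrightarrow> padic_cauchy p (\<lambda>n. - X n)"
  unfolding padic_cauchy_def minus_diff_minus rat_ord_minus[OF p] .

lemma padic_null_add:
  assumes "padic_null p X" "padic_null p Y"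
  shows "padic_null p (\<lambda>n. X n + Y n)"
  unfolding padic_null_iff
proof
  fix K :: real
  obtain N M where N: "\<forall>i\<ge>N. ereal K \<le> rat_ord p (X i)"
    and M: "\<forall>i\<ge>M. ereal K \<le> rat_ord p (Y i)"
    using assms unfolding padic_null_iff by meson
  have "\<forall>i\<ge>max N M. ereal K \<le> rat_ord p (X i + Y i)"
    using rat_ord_add_ge[OF p] N M by simp
  thus "\<exists>N. \<forall>i\<ge>N. ereal K \<le> rat_ord p (X i + Y i)" by blast
qed

lemma padic_null_minus: "padic_null p X \<Longrightarrow> padic_null p (\<lambda>n. - X n)"
  by (simp add: padic_null_def rat_ord_minus[OF p])

lemma padic_cauchy_bounded:
  assumes "padic_cauchy p X"
  obtains B where "\<forall>n. ereal B \<le> rat_ord p (X n)"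
proof -
  obtain N where N: "\<And>i j. i \<ge> N \<Longrightarrow> j \<ge> N \<Longrightarrow> ereal 0 \<le> rat_ord p (X i - X j)"
    using assms unfolding padic_cauchy_def by meson
  have "\<exists>r. ereal r \<le> rat_ord p (X n)" for n
    by (cases "rat_ord p (X n)") (auto simp: rat_ord_def split: if_splits)
  then obtain r where r: "\<And>n. ereal (r n) \<le> rat_ord p (X n)" by metis
  define B where "B = min 0 (Min (r ` {..N}))"
  have B: "B \<le> r n" if "n \<le> N" for n
    unfolding B_def using that by (intro min.coboundedI2 Min_le) auto
  have "ereal B \<le> rat_ord p (X n)" for n
  proof (cases "n \<le> N")
    case True
    thus ?thesis using B by (intro order_trans[OF _ r]) simp
  next
    case False
    have "ereal B \<le> rat_ord p (X n - X N)"
      by (rule order_trans[OF _ N]) (use False in \<open>auto simp: B_def\<close>)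
    moreover have "ereal B \<le> rat_ord p (X N)"
      using B by (intro order_trans[OF _ r]) simp
    ultimately show ?thesis using rat_ord_add_ge[OF p, of "ereal B" "X n - X N" "X N"] by simp
  qed
  thus ?thesis by (intro that) blast
qed

lemma padic_null_mult:
  assumes "padic_cauchy p X" "padic_null p Y"
  shows "padic_null p (\<lambda>n. X n * Y n)"
  unfolding padic_null_iff
proof
  fix K :: real
  obtain B where B: "\<forall>n. ereal B \<le> rat_ord p (X n)"
    using assms(1) by (rule padic_cauchy_bounded) 
  obtain N where N: "\<forall>i\<ge>N. ereal (K - B) \<le> rat_ord p (Y i)"
    using assms(2) unfolding padic_null_iff by meson
  have "\<forall>i\<ge>N. ereal K \<le> rat_ord p (X i * Y i)"
    using rat_ord_mult_ge[OF p B[rule_format], of "K - B"] N by simp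
  thus "\<exists>N. \<forall>i\<ge>N. ereal K \<le> rat_ord p (X i * Y i)" by blast
qed

lemma padic_cauchy_mult:
  assumes "padic_cauchy p X" "padic_cauchy p Y"
  shows "padic_cauchy p (\<lambda>n. X n * Y n)"
  unfolding padic_cauchy_def
proof
  fix K :: real
  obtain A where A: "\<forall>n. ereal A \<le> rat_ord p (X n)"
    using assms(1) by (rule padic_cauchy_bounded) 
  obtain B where B: "\<forall>n. ereal B \<le> rat_ord p (Y n)"
    using assms(2) by (rule padic_cauchy_bounded) 
  obtain N M where N: "\<forall>i\<ge>N. \<forall>j\<ge>N. ereal (K - B) \<le> rat_ord p (X i - X j)"
    and M: "\<forall>i\<ge>M. \<forall>j\<ge>M. ereal (K - A) \<le> rat_ord p (Y i - Y j)"
    using assms unfolding padic_cauchy_def by meson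
  have "ereal K \<le> rat_ord p (X i * Y i - X j * Y j)" if ij: "i \<ge> max N M" "j \<ge> max N M" for i j
  proof -
    have "X i * Y i - X j * Y j = X i * (Y i - Y j) + Y j * (X i - X j)"
      by (simp add: algebra_simps)
    moreover have "ereal K \<le> rat_ord p (X i * (Y i - Y j))"
      using rat_ord_mult_ge[OF p A[rule_format], of "K - A"] M ij by simp
    moreover have "ereal K \<le> rat_ord p (Y j * (X i - X j))"
      using rat_ord_mult_ge[OF p B[rule_format], of "K - B"] N ij by simp
    ultimately show ?thesis using rat_ord_add_ge[OF p] by simp
  qed
  thus "\<exists>N. \<forall>i\<ge>N. \<forall>j\<ge>N. ereal K \<le> rat_ord p (X i * Y i - X j * Y j)" by blast
qed

lemma padic_cauchy_eventually_const:
  assumes "padic_cauchy p X" "\<not> padic_null p X"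
  obtains N c where "\<forall>n\<ge>N. rat_ord p (X n) = ereal c"
proof -
  obtain K where K: "\<And>N. \<exists>n\<ge>N. rat_ord p (X n) < ereal K"
    using assms(2) unfolding padic_null_iff by (meson not_le)
  obtain N where N: "\<And>i j. i \<ge> N \<Longrightarrow> j \<ge> N \<Longrightarrow> ereal K \<le> rat_ord p (X i - X j)"
    using assms(1) unfolding padic_cauchy_def by meson
  obtain n where n: "n \<ge> N" "rat_ord p (X n) < ereal K" using K by blast
  have "X n \<noteq> 0" using n by auto
  then obtain c where "rat_ord p (X n) = ereal c" by (auto simp: rat_ord_def)
  moreover have "rat_ord p (X i) = rat_ord p (X n)" if "i \<ge> N" for i
    by (rule rat_ord_eqI[OF p]) (use N[OF n(1) that] n in auto)
  ultimately show ?thesis using that by metis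
qed

lemma padic_cauchy_inverse:
  assumes "padic_cauchy p X" "\<not> padic_null p X"
  shows "padic_cauchy p (\<lambda>n. inverse (X n))"
  unfolding padic_cauchy_def
proof
  fix K :: real
  obtain N c where c: "\<forall>n\<ge>N. rat_ord p (X n) = ereal c"
    using assms by (rule padic_cauchy_eventually_const) 
  obtain M where M: "\<forall>i\<ge>M. \<forall>j\<ge>M. ereal (K + 2 * c) \<le> rat_ord p (X i - X j)"
    using assms unfolding padic_cauchy_def by meson
  have "ereal K \<le> rat_ord p (inverse (X i) - inverse (X j))" if ij: "i \<ge> max N M" "j \<ge> max N M" for i j
  proof -
    have "X i \<noteq> 0" "X j \<noteq> 0" using c[rule_format, of i] c[rule_format, of j] ij by auto
    hence "rat_ord p (inverse (X i) - inverse (X j)) = rat_ord p (X i - X j) - ereal (2 * c)"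
      using rat_ord_inverse_diff[OF p] c ij by simp
    moreover have "ereal (K + 2 * c) \<le> rat_ord p (X i - X j)" using M ij by simp
    ultimately show ?thesis by (cases "rat_ord p (X i - X j)") auto
  qed
  thus "\<exists>N. \<forall>i\<ge>N. \<forall>j\<ge>N. ereal K \<le> rat_ord p (inverse (X i) - inverse (X j))" by blast
qed

lemma padic_rel_sym: "padic_rel p X Y \<Longrightarrow> padic_rel p Y X"
  unfolding padic_rel_def padic_null_def by (simp add: rat_ord_minus_commute[OF p])

lemma padic_rel_trans: "padic_rel p X Y \<Longrightarrow> padic_rel p Y Z \<Longrightarrow> padic_rel p X Z"
  unfolding padic_rel_def using padic_null_add[of "\<lambda>n. X n - Y n" "\<lambda>n. Y n - Z n"] by simp

lemma padic_rel_refl: "padic_cauchy p X \<Longrightarrow> padic_rel p X X"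
  unfolding padic_rel_def by (simp add: padic_null_zero)

lemma part_equivp_padic_rel: "part_equivp (padic_rel p)"
proof (rule part_equivpI)
  show "\<exists>X. padic_rel p X X" using padic_rel_refl[OF padic_cauchy_const] by blast
  show "symp (padic_rel p)" by (rule sympI) (rule padic_rel_sym)
  show "transp (padic_rel p)" by (rule transpI) (rule padic_rel_trans)
qed

lemma padic_null_cong: "padic_rel p X Y \<Longrightarrow> padic_null p X \<longleftrightarrow> padic_null p Y"
  using padic_null_add[of "\<lambda>n. X n - Y n" Y] padic_null_add[of "\<lambda>n. Y n - X n" X]
    padic_rel_sym[of X Y]
  unfolding padic_rel_def by auto

lemma padic_rel_add:
  "padic_rel p X Y \<Longrightarrow> padic_rel p X' Y' \<Longrightarrow> padic_rel p (\<lambda>n. X n + X' n) (\<lambda>n. Y n + Y' n)"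
  using padic_null_add[of "\<lambda>n. X n - Y n" "\<lambda>n. X' n - Y' n"]
  by (simp add: padic_rel_def padic_cauchy_add algebra_simps)

lemma padic_rel_minus:
  "padic_rel p X Y \<Longrightarrow> padic_rel p (\<lambda>n. - X n) (\<lambda>n. - Y n)"
  using padic_null_minus[of "\<lambda>n. X n - Y n"]
  by (simp add: padic_rel_def padic_cauchy_minus algebra_simps)

lemma padic_rel_mult:
  assumes "padic_rel p X Y" "padic_rel p X' Y'"
  shows "padic_rel p (\<lambda>n. X n * X' n) (\<lambda>n. Y n * Y' n)"
proof -
  have "padic_null p (\<lambda>n. X n * (X' n - Y' n) + Y' n * (X n - Y n))"
    using assms by (intro padic_null_add padic_null_mult) (auto simp: padic_rel_def)
  thus ?thesis using assms
    by (simp add: padic_rel_def padic_cauchy_mult algebra_simps)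
qed

lemma padic_rel_inverse:
  assumes XY: "padic_rel p X Y" and nz: "\<not> padic_null p X"
  shows "padic_rel p (\<lambda>n. inverse (X n)) (\<lambda>n. inverse (Y n))"
proof -
  have c: "padic_cauchy p X" "padic_cauchy p Y" and n: "padic_null p (\<lambda>n. Y n - X n)"
    using XY padic_rel_sym[OF XY] by (auto simp: padic_rel_def)
  have nz': "\<not> padic_null p Y" using padic_null_cong[OF XY] nz by simp
  obtain N a where a: "\<forall>n\<ge>N. rat_ord p (X n) = ereal a"
    using c(1) nz by (rule padic_cauchy_eventually_const) 
  obtain M b where b: "\<forall>n\<ge>M. rat_ord p (Y n) = ereal b"
    using c(2) nz' by (rule padic_cauchy_eventually_const) 
  have "padic_null p (\<lambda>n. (inverse (X n) * inverse (Y n)) * (Y n - X n))"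
    using c nz nz' n by (intro padic_null_mult padic_cauchy_mult padic_cauchy_inverse)
  moreover have "(inverse (X n) * inverse (Y n)) * (Y n - X n) = inverse (X n) - inverse (Y n)"
    if "n \<ge> max N M" for n
  proof -
    have "X n \<noteq> 0" "Y n \<noteq> 0" using a[rule_format, of n] b[rule_format, of n] that by auto
    thus ?thesis by (simp add: field_simps)
  qed
  ultimately have "padic_null p (\<lambda>n. inverse (X n) - inverse (Y n))"
    unfolding padic_null_def
    by (elim Lim_transform_eventually) (auto simp: eventually_sequentially intro!: exI[of _ "max N M"])
  thus ?thesis unfolding padic_rel_def using c nz nz' by (simp add: padic_cauchy_inverse)
qed

lemma padic_rel_inverse_if:
  assumes "padic_rel p X Y"
  shows "padic_rel p (if padic_null p X then (\<lambda>_. 0) else (\<lambda>n. inverse (X n)))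
    (if padic_null p Y then (\<lambda>_. 0) else (\<lambda>n. inverse (Y n)))"
  using padic_rel_inverse[OF assms] padic_null_cong[OF assms]
    padic_rel_refl[OF padic_cauchy_const[of p 0]]
  by (cases "padic_null p X") simp_all

lemma padic_ord_convergent:
  assumes XY: "padic_rel p X Y"
  obtains L where "(\<lambda>n. rat_ord p (X n)) \<longlonglongrightarrow> L" "(\<lambda>n. rat_ord p (Y n)) \<longlonglongrightarrow> L"
proof (cases "padic_null p X")
  case True
  thus ?thesis using that[of \<infinity>] padic_null_cong[OF XY] by (simp add: padic_null_def)
next
  case False
  have "padic_cauchy p X" using XY by (simp add: padic_rel_def)
  then obtain N c where c: "\<forall>n\<ge>N. rat_ord p (X n) = ereal c"
    using False by (rule padic_cauchy_eventually_const)
  obtain M where M: "\<And>n. n \<ge> M \<Longrightarrow> ereal (c + 1) \<le> rat_ord p (X n - Y n)"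
    using XY unfolding padic_rel_def padic_null_iff by blast
  have d: "rat_ord p (Y n) = ereal c" if "n \<ge> max N M" for n
  proof -
    have X: "rat_ord p (X n) = ereal c" using c that by simp
    have "ereal c < ereal (c + 1)" by simp
    also have "\<dots> \<le> rat_ord p (X n - Y n)" using that by (intro M) simp
    finally show ?thesis using rat_ord_eqI[OF p, of "X n" "Y n"] X by simp
  qed
  show ?thesis
  proof (rule that)
    show "(\<lambda>n. rat_ord p (X n)) \<longlonglongrightarrow> ereal c"
      by (rule tendsto_eventually, rule eventually_sequentiallyI[of N]) (use c in simp)
    show "(\<lambda>n. rat_ord p (Y n)) \<longlonglongrightarrow> ereal c"
      by (rule tendsto_eventually, rule eventually_sequentiallyI[of "max N M"]) (use d in simp)
  qed
qed

end

text \<open>$\mathbb{Q}_p$ is the completion of $\mathbb{Q}$ for $|x|_p$, where the prime $p$ is the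
  cardinality of the index type \<open>'p\<close>. The typedef is made by hand because \<open>quotient_type\<close> does
  not accept the sort constraint on \<open>'p\<close>, which does not occur in the representing type.\<close>

typedef ('p::prime_card) padic =
  "{C. \<exists>X. padic_rel CARD('p) X X \<and> C = Collect (padic_rel CARD('p) X)}"
  using padic_rel_refl[OF prime_card padic_cauchy_const] by blast

interpretation padic: quot_type "padic_rel CARD('p::prime_card)" Abs_padic "Rep_padic :: 'p padic \<Rightarrow> _"
proof
  show "part_equivp (padic_rel CARD('p))" by (rule part_equivp_padic_rel[OF prime_card])
  show "\<exists>X. padic_rel CARD('p) X X \<and> Rep_padic x = Collect (padic_rel CARD('p) X)" for x :: "'p padic"
    using Rep_padic[of x] by simp
qed (auto simp: Rep_padic_inverse Abs_padic_inverse Rep_padic_inject)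

definition cr_padic :: "(nat \<Rightarrow> rat) \<Rightarrow> 'p::prime_card padic \<Rightarrow> bool" where
  "cr_padic = (\<lambda>X x. padic_rel CARD('p) X X \<and> padic.abs X = x)"

lemma Quotient_padic: "Quotient (padic_rel CARD('p)) padic.abs (padic.rep :: 'p::prime_card padic \<Rightarrow> _) cr_padic"
  by (rule Quotient3_to_Quotient[OF padic.Quotient]) (simp add: cr_padic_def)

setup_lifting Quotient_padic

instantiation padic :: (prime_card) field
begin

lift_definition zero_padic :: "'a padic" is "\<lambda>_. 0"
  by (rule padic_rel_refl[OF prime_card padic_cauchy_const])

lift_definition one_padic :: "'a padic" is "\<lambda>_. 1"
  by (rule padic_rel_refl[OF prime_card padic_cauchy_const])

lift_definition plus_padic :: "'a padic \<Rightarrow> 'a padic \<Rightarrow> 'a padic" is "\<lambda>X Y n. X n + Y n"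
  by (rule padic_rel_add[OF prime_card])

lift_definition uminus_padic :: "'a padic \<Rightarrow> 'a padic" is "\<lambda>X n. - X n"
  by (rule padic_rel_minus[OF prime_card])

lift_definition times_padic :: "'a padic \<Rightarrow> 'a padic \<Rightarrow> 'a padic" is "\<lambda>X Y n. X n * Y n"
  by (rule padic_rel_mult[OF prime_card])

lift_definition inverse_padic :: "'a padic \<Rightarrow> 'a padic"
  is "\<lambda>X. if padic_null CARD('a) X then (\<lambda>_. 0) else (\<lambda>n. inverse (X n))"
  by (rule padic_rel_inverse_if[OF prime_card])

definition minus_padic :: "'a padic \<Rightarrow> 'a padic \<Rightarrow> 'a padic" where
  "minus_padic x y = x + - y"

definition divide_padic :: "'a padic \<Rightarrow> 'a padic \<Rightarrow> 'a padic" where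
  "divide_padic x y = x * inverse y"

lemmas padic_cauchy_intros =
  padic_cauchy_const padic_cauchy_add[OF prime_card] padic_cauchy_minus[OF prime_card]
  padic_cauchy_mult[OF prime_card]

instance
proof
  fix x y z :: "'a padic"
  show "x + y + z = x + (y + z)"
    by transfer (auto simp: padic_rel_def add.assoc padic_null_zero intro!: padic_cauchy_intros)
  show "x + y = y + x"
    by transfer (auto simp: padic_rel_def add.commute padic_null_zero intro!: padic_cauchy_intros)
  show "0 + x = x"
    by transfer auto
  show "- x + x = 0"
    by transfer (auto simp: padic_rel_def padic_null_zero intro!: padic_cauchy_intros)
  show "x - y = x + - y"
    by (simp add: minus_padic_def)
  show "x * y * z = x * (y * z)"
    by transfer (auto simp: padic_rel_def mult.assoc padic_null_zero intro!: padic_cauchy_intros)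
  show "x * y = y * x"
    by transfer (auto simp: padic_rel_def mult.commute padic_null_zero intro!: padic_cauchy_intros)
  show "1 * x = x"
    by transfer auto
  show "(x + y) * z = x * z + y * z"
    by transfer (auto simp: padic_rel_def distrib_right padic_null_zero intro!: padic_cauchy_intros)
  show "(0::'a padic) \<noteq> 1"
    by transfer (auto simp: padic_rel_def padic_null_def LIMSEQ_const_iff)
  show "inverse x * x = 1" if "x \<noteq> 0"
    using that
  proof transfer
    fix X :: "nat \<Rightarrow> rat"
    assume X: "padic_rel CARD('a) X X" and "\<not> padic_rel CARD('a) X (\<lambda>_. 0)"
    hence c: "padic_cauchy CARD('a) X" and nz: "\<not> padic_null CARD('a) X"
      by (auto simp: padic_rel_def padic_cauchy_const)
    obtain N a where a: "\<forall>n\<ge>N. rat_ord CARD('a) (X n) = ereal a"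
      using c nz by (rule padic_cauchy_eventually_const[OF prime_card])
    have "inverse (X n) * X n - 1 = 0" if "n \<ge> N" for n
    proof -
      have "X n \<noteq> 0" using a[rule_format, of n] that by auto
      thus ?thesis by simp
    qed
    hence "padic_null CARD('a) (\<lambda>n. inverse (X n) * X n - 1)"
      unfolding padic_null_def
      by (intro tendsto_eventually) (auto simp: eventually_sequentially intro!: exI[of _ N])
    thus "padic_rel CARD('a)
        (\<lambda>n. (if padic_null CARD('a) X then \<lambda>_. 0 else (\<lambda>n. inverse (X n))) n * X n) (\<lambda>_. 1)"
      using c nz by (simp add: padic_rel_def padic_cauchy_const padic_cauchy_mult[OF prime_card]
          padic_cauchy_inverse[OF prime_card])
  qed
  show "x div y = x * inverse y"
    by (simp add: divide_padic_def)
  show "inverse (0::'a padic) = 0"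
    by transfer (auto simp: padic_null_zero intro!: padic_rel_refl[OF prime_card] padic_cauchy_const)
qed

end

text \<open>The continuous extension of the valuation; it takes the value $\infty$ at $0$ only.\<close>

lift_definition padic_ord :: "'p::prime_card padic \<Rightarrow> ereal" is "\<lambda>X. lim (\<lambda>n. rat_ord CARD('p) (X n))"
  by (erule padic_ord_convergent[OF prime_card]) (simp add: limI)

lemma padic_const_add: "padic.abs (\<lambda>_. x) + padic.abs (\<lambda>_. y) = (padic.abs (\<lambda>_. x + y) :: 'p::prime_card padic)"
  by (simp add: plus_padic.abs_eq padic_rel_refl[OF prime_card] padic_cauchy_const)

lemma padic_const_minus: "- padic.abs (\<lambda>_. x) = (padic.abs (\<lambda>_. - x) :: 'p::prime_card padic)"
  by (simp add: uminus_padic.abs_eq padic_rel_refl[OF prime_card] padic_cauchy_const)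

lemma padic_const_mult: "padic.abs (\<lambda>_. x) * padic.abs (\<lambda>_. y) = (padic.abs (\<lambda>_. x * y) :: 'p::prime_card padic)"
  by (simp add: times_padic.abs_eq padic_rel_refl[OF prime_card] padic_cauchy_const)

lemma of_nat_padic: "of_nat k = (padic.abs (\<lambda>_. of_nat k) :: 'p::prime_card padic)"
  by (induction k) (simp_all add: zero_padic.abs_eq one_padic.abs_eq padic_const_add)

lemma padic_ord_const: "padic_ord (padic.abs (\<lambda>_. x) :: 'p::prime_card padic) = rat_ord CARD('p) x"
  by (simp add: padic_ord.abs_eq padic_rel_refl[OF prime_card] padic_cauchy_const)

lemma padic_ord_0 [simp]: "padic_ord 0 = \<infinity>"
  by (simp add: zero_padic.abs_eq padic_ord_const)

instance padic :: (prime_card) field_char_0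
proof
  show "inj (of_nat :: nat \<Rightarrow> 'a padic)"
  proof (rule injI, rule ccontr)
    fix j k :: nat
    assume eq: "of_nat j = (of_nat k :: 'a padic)" and ne: "j \<noteq> k"
    have "of_nat j + - of_nat k = (0 :: 'a padic)" by (simp add: eq)
    hence "padic_ord (padic.abs (\<lambda>_. of_nat j + - of_nat k) :: 'a padic) = \<infinity>"
      unfolding of_nat_padic padic_const_minus padic_const_add by simp
    thus False using ne by (simp add: padic_ord_const)
  qed
qed

lemma of_int_padic: "of_int k = (padic.abs (\<lambda>_. of_int k) :: 'p::prime_card padic)"
  by (cases k) (simp_all add: of_nat_padic padic_const_minus flip: of_nat_Suc)

lemma of_rat_padic: "of_rat q = (padic.abs (\<lambda>_. q) :: 'p::prime_card padic)"
proof -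
  obtain a b where q: "q = of_int a / of_int b" "b \<noteq> 0" by (rule rat_as_quotient)
  have "padic.abs (\<lambda>_. q) * of_int b = (of_int a :: 'p padic)"
    using q by (simp add: of_int_padic padic_const_mult)
  hence "padic.abs (\<lambda>_. q) = (of_int a / of_int b :: 'p padic)" using q(2) by (simp add: field_simps)
  thus ?thesis by (simp add: q(1) of_rat_divide)
qed

lemma padic_ord_of_rat: "padic_ord (of_rat q :: 'p::prime_card padic) = rat_ord CARD('p) q"
  by (simp add: of_rat_padic padic_ord_const)

lemma padic_ord_limit:
  fixes x :: "'p::prime_card padic"
  obtains X where "padic_cauchy CARD('p) X" "x = padic.abs X"
    "(\<lambda>n. rat_ord CARD('p) (X n)) \<longlonglongrightarrow> padic_ord x"
proof -
  define X where "X = padic.rep x"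
  have r: "padic_rel CARD('p) X X"
    unfolding X_def by (rule Quotient_rep_reflp[OF Quotient_padic])
  obtain L where L: "(\<lambda>n. rat_ord CARD('p) (X n)) \<longlonglongrightarrow> L"
    using r by (rule padic_ord_convergent[OF prime_card])
  have x: "x = padic.abs X"
    unfolding X_def by (rule Quotient_abs_rep[OF Quotient_padic, symmetric])
  have "padic_ord x = L" using L r by (simp add: x padic_ord.abs_eq limI)
  show ?thesis
    by (rule that[of X]) (use r L x \<open>padic_ord x = L\<close> in \<open>simp_all add: padic_rel_def\<close>)
qed

lemma padic_ord_eq_infinity_iff [simp]: "padic_ord x = \<infinity> \<longleftrightarrow> x = 0"
proof
  assume inf: "padic_ord x = \<infinity>"
  obtain X where X: "padic_cauchy CARD('a) X" "x = padic.abs X"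
      "(\<lambda>n. rat_ord CARD('a) (X n)) \<longlonglongrightarrow> padic_ord x"
    by (rule padic_ord_limit)
  hence "padic_rel CARD('a) X (\<lambda>_. 0)"
    using inf by (simp add: padic_rel_def padic_null_def padic_cauchy_const)
  thus "x = 0" using X by (simp add: zero_padic.abs_eq Quotient_rel_abs[OF Quotient_padic])
qed simp

lemma padic_ord_finite:
  fixes x :: "'p::prime_card padic"
  assumes "x \<noteq> 0"
  obtains c where "padic_ord x = ereal c"
proof -
  obtain X where X: "padic_cauchy CARD('p) X" "x = padic.abs X"
      "(\<lambda>n. rat_ord CARD('p) (X n)) \<longlonglongrightarrow> padic_ord x"
    by (rule padic_ord_limit)
  have "\<not> padic_null CARD('p) X"
    using X(3) assms LIMSEQ_unique padic_ord_eq_infinity_iff unfolding padic_null_def by blast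
  with X(1) obtain N c where c: "\<forall>n\<ge>N. rat_ord CARD('p) (X n) = ereal c"
    by (rule padic_cauchy_eventually_const[OF prime_card])
  have "(\<lambda>n. rat_ord CARD('p) (X n)) \<longlonglongrightarrow> ereal c"
    by (rule tendsto_eventually, rule eventually_sequentiallyI[of N]) (use c in simp)
  thus ?thesis using that X(3) LIMSEQ_unique by blast
qed

lemma padic_ord_add:
  fixes x y :: "'p::prime_card padic"
  shows "min (padic_ord x) (padic_ord y) \<le> padic_ord (x + y)"
proof -
  obtain X where X: "padic_cauchy CARD('p) X" "x = padic.abs X"
      "(\<lambda>n. rat_ord CARD('p) (X n)) \<longlonglongrightarrow> padic_ord x"
    by (rule padic_ord_limit)
  obtain Y where Y: "padic_cauchy CARD('p) Y" "y = padic.abs Y"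
      "(\<lambda>n. rat_ord CARD('p) (Y n)) \<longlonglongrightarrow> padic_ord y"
    by (rule padic_ord_limit)
  let ?Z = "\<lambda>n. X n + Y n"
  have xy: "x + y = padic.abs ?Z"
    using X Y by (simp add: plus_padic.abs_eq padic_rel_refl[OF prime_card])
  have r: "padic_rel CARD('p) ?Z ?Z"
    using X Y by (simp add: padic_rel_refl[OF prime_card] padic_cauchy_add[OF prime_card])
  obtain L where L: "(\<lambda>n. rat_ord CARD('p) (?Z n)) \<longlonglongrightarrow> L"
    using r by (rule padic_ord_convergent[OF prime_card])
  have "padic_ord (x + y) = L" using L r by (simp add: xy padic_ord.abs_eq limI)
  thus ?thesis
    using LIMSEQ_le[OF tendsto_min[OF X(3) Y(3)] L] rat_ord_add[OF prime_card] by blast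
qed

lemma padic_ord_minus [simp]: "padic_ord (- x) = padic_ord x"
  by transfer (simp add: rat_ord_minus[OF prime_card])

instantiation padic :: (prime_card) metric_space
begin

definition dist_padic :: "'a padic \<Rightarrow> 'a padic \<Rightarrow> real" where
  "dist_padic x y =
     (if x = y then 0 else real CARD('a) powr (- real_of_ereal (padic_ord (x - y))))"

definition uniformity_padic :: "('a padic \<times> 'a padic) filter" where
  "uniformity_padic = (INF e\<in>{0<..}. principal {(x, y). dist x y < e})"

definition open_padic :: "'a padic set \<Rightarrow> bool" where
  "open_padic U \<longleftrightarrow> (\<forall>x\<in>U. eventually (\<lambda>(x', y). x' = x \<longrightarrow> y \<in> U) uniformity)"

instance
proof
  fix x y z :: "'a padic"
  show "dist x y = 0 \<longleftrightarrow> x = y"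
    by (simp add: dist_padic_def)
  show "dist x y \<le> dist x z + dist y z"
  proof (cases "x = y \<or> x = z \<or> y = z")
    case True
    thus ?thesis using padic_ord_minus[of "x - y"] by (auto simp: dist_padic_def)
  next
    case False
    obtain a where a: "padic_ord (x - y) = ereal a" using padic_ord_finite[of "x - y"] False by auto
    obtain b where b: "padic_ord (x - z) = ereal b" using padic_ord_finite[of "x - z"] False by auto
    obtain c where c: "padic_ord (y - z) = ereal c" using padic_ord_finite[of "y - z"] False by auto
    have "padic_ord (z - y) = ereal c" using c padic_ord_minus[of "y - z"] by simp
    hence "min b c \<le> a" using padic_ord_add[of "x - z" "z - y"] a b by (auto simp: min_def split: if_splits)
    moreover have "CARD('a) \<ge> 1" by (simp add: Suc_leI)
    ultimately have "real CARD('a) powr - a \<le> real CARD('a) powr - b \<or>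
        real CARD('a) powr - a \<le> real CARD('a) powr - c"
      by (auto simp: min_def intro!: powr_mono split: if_splits)
    moreover have "real CARD('a) powr - b \<ge> 0" "real CARD('a) powr - c \<ge> 0" by simp_all
    ultimately have "real CARD('a) powr - a \<le> real CARD('a) powr - b + real CARD('a) powr - c"
      by linarith
    thus ?thesis using False a b c by (simp add: dist_padic_def)
  qed
qed (simp_all add: uniformity_padic_def open_padic_def)

end

definition padic_int :: "'p::prime_card padic set" where
  "padic_int = {x. 0 \<le> padic_ord x}"

definition pZp :: "'p::prime_card padic set" where
  "pZp = (\<lambda>z. of_nat CARD('p) * z) ` padic_int"

text \<open>The Haar measure of $(\mathbb{Q}_p, +)$ is unique up to scaling; the last conjunct fixes
  the normalization $\mu(pa + p^n\mathbb{Z}_p) = p^{-(n-1)}$.\<close>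

definition normalized_haar :: "'p::prime_card padic measure \<Rightarrow> bool" where
  "normalized_haar \<mu> \<longleftrightarrow>
     sets \<mu> = sets borel \<and>
     (\<forall>a. \<forall>A\<in>sets borel. emeasure \<mu> ((\<lambda>x. a + x) ` A) = emeasure \<mu> A) \<and>
     (\<forall>a. \<forall>n::int.
        emeasure \<mu> ((\<lambda>z. of_nat CARD('p) * a + of_nat CARD('p) powi n * z) ` padic_int)
          = ennreal (real CARD('p) powi (- (n - 1))))"


section \<open>Linear fractional transformations\<close>

text \<open>A point of $\mathbb{Q}_p^m$ is a function in \<open>{1..m} \<rightarrow>\<^sub>E UNIV\<close>, which is undefined outside
  \<open>{1..m}\<close>.\<close>

definition D_set :: "nat \<Rightarrow> (nat \<Rightarrow> 'p::prime_card padic) set" where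
  "D_set m = {x \<in> {1..m} \<rightarrow>\<^sub>E UNIV.
     \<forall>c::nat \<Rightarrow> int. of_int (c 0) + (\<Sum>k=1..m. of_int (c k) * x k) = 0 \<longrightarrow> (\<forall>k\<le>m. c k = 0)}"

definition D_set' :: "nat \<Rightarrow> (nat \<Rightarrow> 'p::prime_card padic) set" where
  "D_set' m = D_set m \<inter> ({1..m} \<rightarrow>\<^sub>E pZp)"

definition lft :: "nat \<Rightarrow> nat \<Rightarrow> (nat \<Rightarrow> nat) \<Rightarrow> (nat \<Rightarrow> rat) \<Rightarrow> (nat \<Rightarrow> rat) \<Rightarrow>
    (nat \<Rightarrow> 'p::prime_card padic) \<Rightarrow> nat \<Rightarrow> 'p padic" where
  "lft m i \<sigma> P Q = (\<lambda>x\<in>D_set m. \<lambda>k\<in>{1..m}.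
     if k = inv \<sigma> i then of_rat (P k) / x i - of_rat (Q k)
     else of_rat (P k) * x (\<sigma> k) / x i - of_rat (Q k))"

definition lft_param :: "nat \<Rightarrow> nat \<Rightarrow> (nat \<Rightarrow> nat) \<Rightarrow> (nat \<Rightarrow> rat) \<Rightarrow> bool" where
  "lft_param m i \<sigma> P \<longleftrightarrow> i \<in> {1..m} \<and> \<sigma> permutes {1..m} \<and> (\<forall>k\<in>{1..m}. P k \<noteq> 0)"

text \<open>The parameters are rational; the predicate below is applied to their images in
  $\mathbb{Q}_p$, which is where the valuation lives.\<close>

definition hyperbolic_param ::
  "nat \<Rightarrow> nat \<Rightarrow> (nat \<Rightarrow> nat) \<Rightarrow> (nat \<Rightarrow> 'p::prime_card padic) \<Rightarrow> (nat \<Rightarrow> 'p padic) \<Rightarrow> bool" where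
  "hyperbolic_param m i \<sigma> P Q \<longleftrightarrow> (let s = inv \<sigma> i in
     (\<forall>k\<in>{1..m}. P k \<noteq> 0 \<and> padic_ord (P k) \<ge> 0) \<and>
     padic_ord (Q s) \<le> 0 \<and> padic_ord (P s / Q s) > 0 \<and>
     (\<forall>k\<in>{1..m}. k \<noteq> s \<and> padic_ord (Q k) \<le> 0 \<longrightarrow>
        padic_ord (P s / Q s) - padic_ord (P k / Q k) > 0) \<and>
     (\<forall>k\<in>{1..m}. k \<noteq> s \<and> padic_ord (Q k) > 0 \<longrightarrow>
        padic_ord (P s / Q s) - padic_ord (P k) > 0))"

definition hyperbolic_lft ::
  "nat \<Rightarrow> ((nat \<Rightarrow> 'p::prime_card padic) \<Rightarrow> nat \<Rightarrow> 'p padic) \<Rightarrow> bool" where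
  "hyperbolic_lft m F \<longleftrightarrow> (\<exists>i \<sigma> P Q. lft_param m i \<sigma> P \<and> F = lft m i \<sigma> P Q \<and>
     hyperbolic_param m i \<sigma> (\<lambda>k. of_rat (P k) :: 'p padic) (\<lambda>k. of_rat (Q k)))"


section \<open>Continued fraction systems\<close>

text \<open>The set $F^{-1}(D_m')$.\<close>

definition cylinder ::
  "nat \<Rightarrow> ((nat \<Rightarrow> 'p::prime_card padic) \<Rightarrow> nat \<Rightarrow> 'p padic) \<Rightarrow> (nat \<Rightarrow> 'p padic) set" where
  "cylinder m F = {x \<in> D_set m. F x \<in> D_set' m}"

definition cf_system ::
  "nat \<Rightarrow> 'l set \<Rightarrow> ('l \<Rightarrow> (nat \<Rightarrow> 'p::prime_card padic) \<Rightarrow> nat \<Rightarrow> 'p padic) \<Rightarrow> bool" where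
  "cf_system m \<Lambda> F \<longleftrightarrow>
     countable \<Lambda> \<and> (\<forall>l\<in>\<Lambda>. hyperbolic_lft m (F l)) \<and>
     disjoint_family_on (\<lambda>l. cylinder m (F l)) \<Lambda> \<and>
     (\<Union>l\<in>\<Lambda>. cylinder m (F l)) = D_set' m"

definition cf_map ::
  "nat \<Rightarrow> 'l set \<Rightarrow> ('l \<Rightarrow> (nat \<Rightarrow> 'p::prime_card padic) \<Rightarrow> nat \<Rightarrow> 'p padic) \<Rightarrow>
    (nat \<Rightarrow> 'p padic) \<Rightarrow> nat \<Rightarrow> 'p padic" where
  "cf_map m \<Lambda> F = (\<lambda>x\<in>D_set' m. F (THE l. l \<in> \<Lambda> \<and> x \<in> cylinder m (F l)) x)"

definition haar_prod ::
  "'p::prime_card padic measure \<Rightarrow> nat \<Rightarrow> (nat \<Rightarrow> 'p padic) measure" where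
  "haar_prod \<mu> m = (\<Pi>\<^sub>M k\<in>{1..m}. restrict_space \<mu> pZp)"

definition ergodic_measure :: "'a measure \<Rightarrow> ('a \<Rightarrow> 'a) \<Rightarrow> bool" where
  "ergodic_measure M T \<longleftrightarrow>
     prob_space M \<and> T \<in> measurable M M \<and>
     (\<forall>A\<in>sets M. emeasure M (T -` A \<inter> space M) = emeasure M A) \<and>
     (\<forall>X\<in>sets M. X = T -` X \<inter> space M \<longrightarrow> emeasure M X = 0 \<or> emeasure M X = 1)"

end

theory Submission
  imports Defs
begin

text \<open>On the polydisc $(p\mathbb{Z}_p)^m$ each branch of $T$ multiplies $\mu_m$ by a constant: in the
  coordinates $x_i$ and $x_{\sigma(k)}$ its inverse is triangular, and hyperbolicity makes the
  absolute value of each diagonal derivative constant. The constants sum to $1$, so $\mu_m$ is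
  invariant. Moreover the inverse branches contract all distances by the factor $p$. For an invariant
  set $X$, induction on $n$ therefore gives $\mu_m(X \cap A) = \mu_m(X)\,\mu_m(A)$ for every union
  $A$ of polyballs of radius $p^{-n}$: within the domain of a branch, such an $A$ is the preimage
  under the branch of a union of polyballs of radius $p^{-(n-1)}$. These sets $A$ generate the
  Borel sets, and $A = X$ yields $\mu_m(X) = \mu_m(X)^2$.\<close>

section \<open>The integer valuation\<close>

text \<open>The factor of a branch is exactly constant because of the ultrametric inequality: for
  \<open>y\<close> in the polydisc, \<open>y s\<close> has valuation at least 1 and
  \<open>b s\<close> at most 0, so \<open>b s + y s\<close> has the valuation of \<open>b s\<close>,
  and \<open>x i\<close> has the same valuation \<open>e\<close> on the whole image of the inverse
  branch. Independence of \<open>X\<close> from balls is therefore an equality at every level, in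
  place of a distortion estimate with density points. The obstacle is the set
  \<open>D_set' m\<close> on which T lives: it contains no polyball, whereas the measure is known on
  balls. A branch is therefore studied through its formula at all points of the polydisc with
  \<open>x i\<close> nonzero, where preimages of polyballs are open and Fubini applies. Only
  afterwards is \<open>D_set' m\<close> cut out; its complement is a countable union of rational
  hyperplanes, each of measure zero. The factor p comes from integrality: a strict inequality
  between valuations is a gain of at least 1. This is why the valuation is first recast with values
  in \<open>int\<close>.\<close>

definition padic_val :: "'p::prime_card padic \<Rightarrow> int" where
  "padic_val x = \<lfloor>real_of_ereal (padic_ord x)\<rfloor>"

text \<open>The fractional ideal p^n Z_p. It is defined through \<open>padic_ord\<close>, so that 0
  belongs to every ideal; \<open>padic_val 0\<close> is only the default value 0.\<close>

definition padic_ideal :: "int \<Rightarrow> 'p::prime_card padic set" where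
  "padic_ideal n = {x. ereal (of_int n) \<le> padic_ord x}"

lemma rat_ord_int:
  assumes "x \<noteq> 0"
  obtains k :: int where "rat_ord q x = ereal (of_int k)"
  using that[of "int (multiplicity (int q) (fst (quotient_of x)))
      - int (multiplicity (int q) (snd (quotient_of x)))"] assms
  by (simp add: rat_ord_def)

text \<open>A rational Cauchy sequence that is not null has eventually constant valuation, so the
  limit inherits the valuation of a nonzero rational, which is an integer.\<close>

lemma padic_ord_eq_val:
  fixes x :: "'p::prime_card padic"
  assumes "x \<noteq> 0"
  shows "padic_ord x = ereal (of_int (padic_val x))"
proof -
  obtain X where X: "padic_cauchy CARD('p) X" "x = padic.abs X"
      "(\<lambda>n. rat_ord CARD('p) (X n)) \<longlonglongrightarrow> padic_ord x"
    by (rule padic_ord_limit)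
  have "\<not> padic_null CARD('p) X"
    using X(3) assms LIMSEQ_unique padic_ord_eq_infinity_iff unfolding padic_null_def by blast
  with X(1) obtain N c where c: "\<forall>n\<ge>N. rat_ord CARD('p) (X n) = ereal c"
    by (rule padic_cauchy_eventually_const[OF prime_card])
  have "(\<lambda>n. rat_ord CARD('p) (X n)) \<longlonglongrightarrow> ereal c"
    by (rule tendsto_eventually, rule eventually_sequentiallyI[of N]) (use c in simp)
  hence ord: "padic_ord x = ereal c" using X(3) LIMSEQ_unique by blast
  have N: "rat_ord CARD('p) (X N) = ereal c" using c by simp
  hence "X N \<noteq> 0" by auto
  then obtain k :: int where "rat_ord CARD('p) (X N) = ereal (of_int k)" by (rule rat_ord_int)
  thus ?thesis using ord N by (simp add: padic_val_def)
qed

lemma padic_ideal_iff: "x \<in> padic_ideal n \<longleftrightarrow> x = 0 \<or> n \<le> padic_val x"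
  by (cases "x = 0") (simp_all add: padic_ideal_def padic_ord_eq_val)

lemma padic_ideal_0 [simp]: "0 \<in> padic_ideal n"
  by (simp add: padic_ideal_iff)

lemma padic_ideal_antimono: "x \<in> padic_ideal n \<Longrightarrow> k \<le> n \<Longrightarrow> x \<in> padic_ideal k"
  by (auto simp: padic_ideal_iff)

lemma padic_ideal_add: "x \<in> padic_ideal n \<Longrightarrow> y \<in> padic_ideal n \<Longrightarrow> x + y \<in> padic_ideal n"
  using padic_ord_add[of x y] unfolding padic_ideal_def by (auto simp: min_def split: if_splits)

lemma padic_ideal_minus_iff [simp]: "- x \<in> padic_ideal n \<longleftrightarrow> x \<in> padic_ideal n"
  by (simp add: padic_ideal_def)

lemma padic_ideal_diff: "x \<in> padic_ideal n \<Longrightarrow> y \<in> padic_ideal n \<Longrightarrow> x - y \<in> padic_ideal n"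
  using padic_ideal_add[of x n "- y"] by simp

lemma padic_ideal_commute: "x - y \<in> padic_ideal n \<longleftrightarrow> y - x \<in> padic_ideal n"
  using padic_ideal_minus_iff[of "x - y" n] by simp

lemma padic_ideal_trans:
  "x - y \<in> padic_ideal n \<Longrightarrow> y - z \<in> padic_ideal n \<Longrightarrow> x - z \<in> padic_ideal n"
  using padic_ideal_add[of "x - y" n "y - z"] by simp

lemma padic_ideal_sum:
  "(\<And>k. k \<in> I \<Longrightarrow> f k \<in> padic_ideal n) \<Longrightarrow> sum f I \<in> padic_ideal n"
  by (induction I rule: infinite_finite_induct) (auto intro: padic_ideal_add)

text \<open>Valuations add termwise along representing sequences. The sum passes to the limit
  because both limits are finite, which is where nonzero factors enter.\<close>

lemma padic_val_mult:
  fixes x y :: "'p::prime_card padic"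
  assumes "x \<noteq> 0" "y \<noteq> 0"
  shows "padic_val (x * y) = padic_val x + padic_val y"
proof -
  obtain X where X: "padic_cauchy CARD('p) X" "x = padic.abs X"
      "(\<lambda>n. rat_ord CARD('p) (X n)) \<longlonglongrightarrow> padic_ord x"
    by (rule padic_ord_limit)
  obtain Y where Y: "padic_cauchy CARD('p) Y" "y = padic.abs Y"
      "(\<lambda>n. rat_ord CARD('p) (Y n)) \<longlonglongrightarrow> padic_ord y"
    by (rule padic_ord_limit)
  let ?Z = "\<lambda>n. X n * Y n"
  have xy: "x * y = padic.abs ?Z"
    using X Y by (simp add: times_padic.abs_eq padic_rel_refl[OF prime_card])
  have r: "padic_rel CARD('p) ?Z ?Z"
    using X Y by (simp add: padic_rel_refl[OF prime_card] padic_cauchy_mult[OF prime_card])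
  obtain L where L: "(\<lambda>n. rat_ord CARD('p) (?Z n)) \<longlonglongrightarrow> L"
    using r by (rule padic_ord_convergent[OF prime_card])
  have "padic_ord (x * y) = L" using L r by (simp add: xy padic_ord.abs_eq limI)
  moreover have "(\<lambda>n. rat_ord CARD('p) (?Z n)) \<longlonglongrightarrow> padic_ord x + padic_ord y"
    unfolding rat_ord_mult[OF prime_card]
    by (rule tendsto_add_ereal) (use X Y assms in \<open>simp_all add: padic_ord_eq_val\<close>)
  ultimately have "padic_ord (x * y) = padic_ord x + padic_ord y"
    using L LIMSEQ_unique by blast
  thus ?thesis using assms by (simp add: padic_ord_eq_val flip: of_int_add)
qed

lemma padic_val_divide:
  "x \<noteq> 0 \<Longrightarrow> y \<noteq> 0 \<Longrightarrow> padic_val (x / y) = padic_val x - padic_val y"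
  using padic_val_mult[of "x / y" y] by simp

lemma padic_ideal_mult: "x \<in> padic_ideal n \<Longrightarrow> y \<in> padic_ideal k \<Longrightarrow> x * y \<in> padic_ideal (n + k)"
  by (cases "x = 0 \<or> y = 0") (auto simp: padic_ideal_iff padic_val_mult)

lemma padic_ideal_mult_iff:
  "a \<noteq> 0 \<Longrightarrow> a * x \<in> padic_ideal n \<longleftrightarrow> x \<in> padic_ideal (n - padic_val a)"
  by (cases "x = 0") (auto simp: padic_ideal_iff padic_val_mult)

lemma padic_ideal_divide_iff:
  "a \<noteq> 0 \<Longrightarrow> x / a \<in> padic_ideal n \<longleftrightarrow> x \<in> padic_ideal (n + padic_val a)"
  by (cases "x = 0") (auto simp: padic_ideal_iff padic_val_divide)

text \<open>Ultrametric stability: a perturbation of strictly larger valuation changes neither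
  nonvanishing nor the valuation. Every local constancy claim below rests on this.\<close>

lemma padic_val_eqI:
  assumes "x \<noteq> 0" "y - x \<in> padic_ideal (padic_val x + 1)"
  shows "y \<noteq> 0" "padic_val y = padic_val x"
proof -
  have nx: "x \<notin> padic_ideal (padic_val x + 1)" using assms by (simp add: padic_ideal_iff)
  show y: "y \<noteq> 0"
    using assms nx by auto
  have "y \<notin> padic_ideal (padic_val x + 1)"
    using nx padic_ideal_diff[OF _ assms(2), of y] by auto
  moreover have "y \<in> padic_ideal (padic_val x)"
    using padic_ideal_add[of "y - x" "padic_val x" x] assms
      padic_ideal_antimono[OF assms(2), of "padic_val x"] by (simp add: padic_ideal_iff)
  ultimately show "padic_val y = padic_val x" using y by (simp add: padic_ideal_iff)
qed

lemma of_int_padic_ideal: "of_int k \<in> (padic_ideal 0 :: 'p::prime_card padic set)"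
proof (cases "k = 0")
  case False
  have "padic_ord (of_rat (of_int k) :: 'p padic) = rat_ord CARD('p) (of_int k)"
    by (rule padic_ord_of_rat)
  thus ?thesis by (simp add: padic_ideal_def rat_ord_def zero_ereal_def)
qed simp

lemma padic_val_prime: "padic_val (of_nat CARD('p) :: 'p::prime_card padic) = 1"
proof -
  have "padic_ord (of_rat (of_nat CARD('p)) :: 'p padic) = rat_ord CARD('p) (of_nat CARD('p))"
    by (rule padic_ord_of_rat)
  moreover have "multiplicity (int CARD('p)) (int CARD('p)) = 1"
    using not_unit_p[OF prime_card[where 'a='p]] by (intro multiplicity_self) auto
  moreover have "quotient_of (of_nat CARD('p)) = (int CARD('p), 1)"
    using quotient_of_int[of "int CARD('p)"] by simp
  ultimately show ?thesis by (simp add: padic_val_def rat_ord_def)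
qed

lemma padic_val_prime_power:
  "padic_val (of_nat CARD('p) powi n :: 'p::prime_card padic) = n"
proof -
  have nat: "padic_val (of_nat CARD('p) ^ k :: 'p padic) = int k" for k
  proof (induction k)
    case 0
    show ?case using padic_val_mult[of "1 :: 'p padic" 1] by simp
  next
    case (Suc k)
    have "of_nat CARD('p) ^ k \<noteq> (0 :: 'p padic)" by simp
    thus ?case using Suc
      by (simp add: padic_val_mult padic_val_prime del: of_nat_power)
  qed
  show ?thesis
    using nat[of "nat n"] nat[of "nat (-n)"] nat[of 0]
      padic_val_divide[of "1 :: 'p padic" "of_nat CARD('p) ^ nat (- n)"]
    by (cases "n \<ge> 0") (simp_all add: power_int_def inverse_eq_divide power_one_over del: of_nat_power)
qed

section \<open>Balls as cosets of ideals, and the topology of Q_p\<close>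

lemma padic_int_eq: "padic_int = padic_ideal 0"
  by (simp add: padic_int_def padic_ideal_def zero_ereal_def)

text \<open>Translates the balls of \<open>normalized_haar\<close>, given as images of
  \<open>padic_int\<close>, into congruences modulo an ideal.\<close>

lemma padic_ball_eq:
  "(\<lambda>z. c + of_nat CARD('p) powi n * z) ` padic_int = {x :: 'p::prime_card padic. x - c \<in> padic_ideal n}"
proof (intro equalityI subsetI)
  fix x assume "x \<in> (\<lambda>z. c + of_nat CARD('p) powi n * z) ` (padic_int :: 'p padic set)"
  thus "x \<in> {x. x - c \<in> padic_ideal n}"
    by (auto simp: padic_int_eq padic_ideal_mult_iff padic_val_prime_power)
next
  fix x :: "'p padic" assume "x \<in> {x. x - c \<in> padic_ideal n}"
  hence "x = c + of_nat CARD('p) powi n * ((x - c) / of_nat CARD('p) powi n)"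
    "(x - c) / of_nat CARD('p) powi n \<in> padic_int"
    by (auto simp: padic_int_eq padic_ideal_divide_iff padic_val_prime_power)
  thus "x \<in> (\<lambda>z. c + of_nat CARD('p) powi n * z) ` padic_int" by blast
qed

lemma pZp_eq: "(pZp :: 'p::prime_card padic set) = padic_ideal 1"
  using padic_ball_eq[of "0 :: 'p padic" 1] by (simp add: pZp_def)

lemma open_padic_iff:
  fixes U :: "'p::prime_card padic set"
  shows "open U \<longleftrightarrow> (\<forall>x\<in>U. \<exists>n::nat. \<forall>y. y - x \<in> padic_ideal (int n) \<longrightarrow> y \<in> U)"
proof -
  have p: "real CARD('p) > 1" using prime_gt_1_nat[OF prime_card[where 'a='p]] by simp
  have dist: "dist y x < real CARD('p) powr (- k) \<longleftrightarrow> y = x \<or> k < real_of_int (padic_val (y - x))"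
    for x y :: "'p padic" and k
    using p by (auto simp: dist_padic_def padic_ord_eq_val)
  show ?thesis unfolding open_dist
  proof (intro ball_cong refl iffI)
    fix x assume "\<exists>e>0. \<forall>y. dist y x < e \<longrightarrow> y \<in> U"
    then obtain e where e: "e > 0" "\<And>y. dist y x < e \<Longrightarrow> y \<in> U" by blast
    \<comment> \<open>A difference of valuation at least \<open>n\<close> has absolute value at most
      p^(-n), which is below p^(log_p e) = e.\<close>
    obtain n :: nat where n: "- log CARD('p) e < n" using reals_Archimedean2 by blast
    have "y \<in> U" if "y - x \<in> padic_ideal (int n)" for y
    proof (rule e(2))
      have "dist y x < real CARD('p) powr (- (- log CARD('p) e))"
        unfolding dist using that n by (auto simp: padic_ideal_iff)
      thus "dist y x < e" using e p by simp
    qed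
    thus "\<exists>n::nat. \<forall>y. y - x \<in> padic_ideal (int n) \<longrightarrow> y \<in> U" by blast
  next
    fix x assume "\<exists>n::nat. \<forall>y. y - x \<in> padic_ideal (int n) \<longrightarrow> y \<in> U"
    then obtain n :: nat where n: "\<And>y. y - x \<in> padic_ideal (int n) \<Longrightarrow> y \<in> U" by blast
    have "y \<in> U" if "dist y x < real CARD('p) powr (- real n)" for y
      using that unfolding dist by (intro n) (auto simp: padic_ideal_iff)
    moreover have "real CARD('p) powr (- real n) > 0" using p by simp
    ultimately show "\<exists>e>0. \<forall>y. dist y x < e \<longrightarrow> y \<in> U" by blast
  qed
qed

text \<open>Late terms of a representing Cauchy sequence approximate its limit. Density of the
  rationals is what yields a countable base of polyballs.\<close>

lemma padic_rat_dense:
  fixes x :: "'p::prime_card padic"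
  obtains q :: rat where "x - of_rat q \<in> padic_ideal n"
proof -
  obtain X where X: "padic_cauchy CARD('p) X" "x = padic.abs X" by (rule padic_ord_limit)
  obtain N where N: "\<And>i j. i \<ge> N \<Longrightarrow> j \<ge> N \<Longrightarrow> ereal (of_int n) \<le> rat_ord CARD('p) (X i - X j)"
    using X(1) unfolding padic_cauchy_def by meson
  let ?Z = "\<lambda>i. X i + - X N"
  have c: "padic_cauchy CARD('p) ?Z"
    using X(1) by (intro padic_cauchy_add[OF prime_card] padic_cauchy_const)
  have "x - of_rat (X N) = padic.abs ?Z"
    using X c by (simp add: of_rat_padic minus_padic_def uminus_padic.abs_eq plus_padic.abs_eq
        padic_rel_refl[OF prime_card] padic_cauchy_const)
  moreover obtain L where L: "(\<lambda>i. rat_ord CARD('p) (?Z i)) \<longlonglongrightarrow> L"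
    using padic_ord_convergent[OF prime_card padic_rel_refl[OF prime_card c]] by blast
  ultimately have "padic_ord (x - of_rat (X N)) = L"
    using c by (simp add: padic_ord.abs_eq limI padic_rel_refl[OF prime_card])
  moreover have "ereal (of_int n) \<le> L"
    by (rule LIMSEQ_le_const[OF L], rule exI[of _ N]) (use N in simp)
  ultimately show ?thesis by (intro that[of "X N"]) (simp add: padic_ideal_def)
qed

section \<open>Polyballs and the product measure\<close>

definition polyball :: "nat \<Rightarrow> (nat \<Rightarrow> 'p::prime_card padic) \<Rightarrow> int \<Rightarrow> (nat \<Rightarrow> 'p padic) set" where
  "polyball m c n = (\<Pi>\<^sub>E k\<in>{1..m}. {x. x - c k \<in> padic_ideal n})"

definition polydisc :: "nat \<Rightarrow> (nat \<Rightarrow> 'p::prime_card padic) set" where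
  "polydisc m = ({1..m} \<rightarrow>\<^sub>E pZp)"

text \<open>The empty set makes the family closed under intersection, since two polyballs are either
  nested or disjoint. The bound on \<open>n\<close> keeps them inside the polydisc.\<close>

definition polyballs :: "nat \<Rightarrow> (nat \<Rightarrow> 'p::prime_card padic) set set" where
  "polyballs m = insert {} {polyball m c n |c n. c \<in> polydisc m \<and> n \<ge> 1}"

definition polyopen :: "nat \<Rightarrow> (nat \<Rightarrow> 'p::prime_card padic) set \<Rightarrow> bool" where
  "polyopen m A \<longleftrightarrow> A \<subseteq> polydisc m \<and> (\<forall>x\<in>A. \<exists>n. polyball m x n \<subseteq> A)"

lemma polyball_antimono: "n \<le> k \<Longrightarrow> polyball m c k \<subseteq> polyball m c n"
  unfolding polyball_def by (rule PiE_mono) (auto intro: padic_ideal_antimono)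

lemma polyball_center: "x \<in> polydisc m \<Longrightarrow> x \<in> polyball m x n"
  by (auto simp: polyball_def polydisc_def PiE_iff)

text \<open>Congruence modulo an ideal is an equivalence relation and a polyball is a coordinatewise
  class, so any of its points serves as centre.\<close>

lemma polyball_recenter: "x \<in> polyball m c n \<Longrightarrow> polyball m c n = polyball m x n"
  unfolding polyball_def
proof (rule PiE_cong)
  fix k assume "x \<in> (\<Pi>\<^sub>E k\<in>{1..m}. {x. x - c k \<in> padic_ideal n})" "k \<in> {1..m}"
  hence "x k - c k \<in> padic_ideal n" by auto
  thus "{x. x - c k \<in> padic_ideal n} = {y. y - x k \<in> padic_ideal n}"
    using padic_ideal_trans padic_ideal_commute by blast
qed

lemma polydisc_eq_polyball: "c \<in> polydisc m \<Longrightarrow> polydisc m = polyball m c 1"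
proof -
  assume c: "c \<in> polydisc m"
  have "polydisc m = polyball m (\<lambda>_. 0) 1" by (simp add: polydisc_def polyball_def pZp_eq)
  thus ?thesis using polyball_recenter c by metis
qed

lemma polyball_subset_polydisc: "c \<in> polydisc m \<Longrightarrow> n \<ge> 1 \<Longrightarrow> polyball m c n \<subseteq> polydisc m"
  using polydisc_eq_polyball polyball_antimono by metis

lemma polyball_Int_in_polyballs:
  assumes "n \<ge> 1"
  shows "polyball m c n \<inter> polydisc m \<in> polyballs m"
proof (cases "polyball m c n \<inter> polydisc m = {}")
  case False
  then obtain x where x: "x \<in> polyball m c n" "x \<in> polydisc m" by blast
  hence "polyball m c n \<inter> polydisc m = polyball m x n"
    using polyball_recenter polyball_subset_polydisc assms by blast
  thus ?thesis using x assms by (auto simp: polyballs_def)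
qed (simp add: polyballs_def)

lemma polyballs_subset: "polyballs m \<subseteq> Pow (polydisc m)"
  using polyball_subset_polydisc by (auto simp: polyballs_def)

lemma polyballsE:
  assumes "A \<in> polyballs m" "x \<in> A"
  obtains n where "A = polyball m x n" "n \<ge> 1"
proof -
  obtain c n where "A = polyball m c n" "n \<ge> 1" using assms by (auto simp: polyballs_def)
  thus ?thesis using that polyball_recenter[of x m c n] assms(2) by simp
qed

lemma polydisc_in_polyballs: "(polydisc m :: (nat \<Rightarrow> 'p::prime_card padic) set) \<in> polyballs m"
proof -
  have z: "(\<lambda>k\<in>{1..m}. 0 :: 'p padic) \<in> polydisc m" by (auto simp: polydisc_def pZp_eq)
  show ?thesis unfolding polydisc_eq_polyball[OF z] using z by (auto simp: polyballs_def)
qed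

lemma sets_sigma_polyballs [simp]:
  "sets (sigma (polydisc m) (polyballs m)) = sigma_sets (polydisc m) (polyballs m)"
  by (rule sets_measure_of[OF polyballs_subset])

lemma Int_stable_polyballs: "Int_stable (polyballs m)"
proof (rule Int_stableI)
  fix A B :: "(nat \<Rightarrow> 'a padic) set"
  assume AB: "A \<in> polyballs m" "B \<in> polyballs m"
  show "A \<inter> B \<in> polyballs m"
  proof (cases "A \<inter> B = {}")
    case False
    then obtain x where x: "x \<in> A" "x \<in> B" by blast
    obtain n where n: "A = polyball m x n" "n \<ge> 1" using AB(1) x(1) by (rule polyballsE)
    obtain k where k: "B = polyball m x k" "k \<ge> 1" using AB(2) x(2) by (rule polyballsE)
    have "A \<inter> B = polyball m x (max n k)"
    proof (cases "n \<le> k")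
      case True
      thus ?thesis using polyball_antimono[of n k m x] n(1) k(1) by (simp add: Int_absorb1)
    next
      case False
      thus ?thesis using polyball_antimono[of k n m x] n(1) k(1) by (simp add: Int_absorb2)
    qed
    moreover have "x \<in> polydisc m" using x AB(1) polyballs_subset by blast
    moreover have "max n k \<ge> 1" using n by simp
    ultimately show ?thesis unfolding polyballs_def by blast
  qed (simp add: polyballs_def)
qed

text \<open>Polyballs with rational centres are countable in number and form a base, so a union of
  arbitrarily many polyballs reduces to a countable one.\<close>

lemma polyopen_in_sigma:
  fixes A :: "(nat \<Rightarrow> 'p::prime_card padic) set"
  assumes "polyopen m A"
  shows "A \<in> sigma_sets (polydisc m) (polyballs m)"
proof -
  let ?Q = "({1..m} \<rightarrow>\<^sub>E (UNIV :: rat set)) \<times> (UNIV :: nat set)"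
  \<comment> \<open>A rational centre need not lie in the polydisc, hence the intersection; it is
    again empty or a polyball, by recentring at one of its points.\<close>
  define B :: "(nat \<Rightarrow> rat) \<times> nat \<Rightarrow> (nat \<Rightarrow> 'p padic) set"
    where "B = (\<lambda>(q, n). polyball m (\<lambda>k. of_rat (q k)) (int n + 1) \<inter> polydisc m)"
  define I where "I = {i \<in> ?Q. B i \<subseteq> A}"
  have "countable ?Q" by (intro countable_SIGMA countable_PiE) auto
  hence cI: "countable I" unfolding I_def by (rule countable_subset[rotated]) auto
  have "A \<subseteq> (\<Union>i\<in>I. B i)"
  proof
    fix x assume x: "x \<in> A"
    hence xd: "x \<in> polydisc m" using assms by (auto simp: polyopen_def)
    obtain n where n: "polyball m x n \<subseteq> A" using x assms by (auto simp: polyopen_def)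
    \<comment> \<open>\<open>n\<close> may be negative; the level \<open>int (nat n) + 1\<close> is
      at least 1 and at least \<open>n\<close>, so it stays inside both the polydisc and
      \<open>A\<close>.\<close>
    have "\<exists>q. x k - of_rat q \<in> padic_ideal (int (nat n) + 1)" for k
      by (rule padic_rat_dense[of "x k" "int (nat n) + 1"]) blast
    then obtain q where q: "\<And>k. x k - of_rat (q k) \<in> padic_ideal (int (nat n) + 1)" by metis
    define r where "r = restrict q {1..m}"
    have xr: "x \<in> polyball m (\<lambda>k. of_rat (r k)) (int (nat n) + 1)"
      using q xd by (auto simp: polyball_def r_def polydisc_def PiE_iff)
    have "polyball m (\<lambda>k. of_rat (r k)) (int (nat n) + 1) \<subseteq> A"
      unfolding polyball_recenter[OF xr] using n by (rule order_trans[OF polyball_antimono, rotated]) simp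
    hence "(r, nat n) \<in> I" by (auto simp: I_def B_def r_def)
    moreover have "x \<in> B (r, nat n)" using xr xd by (simp add: B_def)
    ultimately show "x \<in> (\<Union>i\<in>I. B i)" by blast
  qed
  hence A: "A = (\<Union>i\<in>I. B i)" by (auto simp: I_def)
  have "B i \<in> sets (sigma (polydisc m) (polyballs m))" for i
    unfolding B_def case_prod_beta sets_sigma_polyballs
    by (intro sigma_sets.Basic polyball_Int_in_polyballs) simp
  hence "(\<Union>i\<in>I. B i) \<in> sets (sigma (polydisc m) (polyballs m))"
    by (intro sets.countable_UN' cI image_subsetI)
  thus ?thesis unfolding A sets_sigma_polyballs .
qed

lemma open_padic_ball: "open {x :: 'p::prime_card padic. x - c \<in> padic_ideal n}"
  unfolding open_padic_iff
proof clarify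
  fix x assume x: "x - c \<in> padic_ideal n"
  have "y - c \<in> padic_ideal n" if "y - x \<in> padic_ideal (int (nat n))" for y
    using padic_ideal_trans[OF _ x, of y] padic_ideal_antimono[OF that, of n] by simp
  thus "\<exists>k. \<forall>y. y - x \<in> padic_ideal (int k) \<longrightarrow> y \<in> {x. x - c \<in> padic_ideal n}" by blast
qed

lemma polyopen_vimage:
  assumes "open U" "k \<in> {1..m}"
  shows "polyopen m {x \<in> polydisc m. x k \<in> U}"
  unfolding polyopen_def
proof (intro conjI ballI)
  fix x assume x: "x \<in> {x \<in> polydisc m. x k \<in> U}"
  then obtain n :: nat where n: "\<And>y. y - x k \<in> padic_ideal (int n) \<Longrightarrow> y \<in> U"
    using assms(1) unfolding open_padic_iff by blast
  have "polyball m x (int n + 1) \<subseteq> polydisc m"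
    using x by (intro polyball_subset_polydisc) auto
  moreover have "y k \<in> U" if "y \<in> polyball m x (int n + 1)" for y
  proof (rule n)
    have "y k - x k \<in> padic_ideal (int n + 1)" using that assms(2) by (auto simp: polyball_def)
    thus "y k - x k \<in> padic_ideal (int n)" by (rule padic_ideal_antimono) simp
  qed
  ultimately show "\<exists>n. polyball m x n \<subseteq> {x \<in> polydisc m. x k \<in> U}" by blast
qed auto

section \<open>Measures of balls and polyballs\<close>

locale padic_haar =
  fixes \<mu> :: "'p::prime_card padic measure"
  assumes haar: "normalized_haar \<mu>"
begin

abbreviation (input) \<nu> where "\<nu> \<equiv> restrict_space \<mu> pZp"

lemma sets_haar: "sets \<mu> = sets borel"
  using haar by (simp add: normalized_haar_def)

lemma space_haar: "space \<mu> = UNIV"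
  using sets_eq_imp_space_eq[OF sets_haar] by simp

lemma emeasure_ball:
  "emeasure \<mu> {x. x - c \<in> padic_ideal n} = ennreal (real CARD('p) powi (1 - n))"
proof -
  \<comment> \<open>The normalization speaks of centres p a with \<open>a\<close> in all of Q_p, so
    an arbitrary centre \<open>c\<close> is reached by a = c / p.\<close>
  have "emeasure \<mu> ((\<lambda>z. of_nat CARD('p) * (c / of_nat CARD('p)) + of_nat CARD('p) powi n * z) ` padic_int)
      = ennreal (real CARD('p) powi (- (n - 1)))"
    using haar unfolding normalized_haar_def by blast
  thus ?thesis by (simp add: padic_ball_eq)
qed

lemma ball_in_sets: "{x. x - c \<in> padic_ideal n} \<in> sets \<mu>"
  unfolding sets_haar using open_padic_ball by (rule borel_open)

lemma pZp_in_sets: "pZp \<in> sets \<mu>"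
  using ball_in_sets[of 0 1] by (simp add: pZp_eq)

lemma space_restrict: "space \<nu> = pZp"
  by (simp add: space_restrict_space space_haar)

lemma emeasure_restrict_ball:
  assumes "c \<in> pZp" "n \<ge> 1"
  shows "{x. x - c \<in> padic_ideal n} \<in> sets \<nu>"
    and "emeasure \<nu> {x. x - c \<in> padic_ideal n} = ennreal (real CARD('p) powi (1 - n))"
proof -
  have sub: "{x. x - c \<in> padic_ideal n} \<subseteq> pZp"
  proof clarify
    fix x assume "x - c \<in> padic_ideal n"
    hence "x - c \<in> padic_ideal 1" using assms(2) by (rule padic_ideal_antimono)
    thus "x \<in> pZp" using padic_ideal_add[of "x - c" 1 c] assms(1) by (simp add: pZp_eq)
  qed
  show "{x. x - c \<in> padic_ideal n} \<in> sets \<nu>"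
    using sub ball_in_sets pZp_in_sets by (subst sets_restrict_space_iff) (simp_all add: space_haar)
  show "emeasure \<nu> {x. x - c \<in> padic_ideal n} = ennreal (real CARD('p) powi (1 - n))"
    using sub pZp_in_sets by (subst emeasure_restrict_space) (simp_all add: space_haar emeasure_ball)
qed

lemma prob_space_restrict: "prob_space \<nu>"
  using emeasure_restrict_ball(2)[of 0 1] by (intro prob_spaceI, unfold space_restrict) (simp add: pZp_eq)

text \<open>A point lies in balls of measure p^(-n) for every \<open>n\<close>.\<close>

lemma emeasure_restrict_singleton:
  assumes "y \<in> pZp"
  shows "{y} \<in> sets \<nu>" "emeasure \<nu> {y} = 0"
proof -
  have "{y} \<in> sets \<mu>" unfolding sets_haar by simp
  thus "{y} \<in> sets \<nu>"
    using pZp_in_sets assms by (subst sets_restrict_space_iff) (simp_all add: space_haar)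
  have p: "real CARD('p) > 1" using prime_gt_1_nat[OF prime_card[where 'a='p]] by simp
  have "emeasure \<nu> {y} \<le> ennreal (inverse (real CARD('p)) ^ n)" for n :: nat
  proof -
    have "emeasure \<nu> {y} \<le> emeasure \<nu> {x. x - y \<in> padic_ideal (int n + 1)}"
      using emeasure_restrict_ball(1)[OF assms] by (intro emeasure_mono) auto
    also have "\<dots> = ennreal (real CARD('p) powi (1 - (int n + 1)))"
      using assms by (rule emeasure_restrict_ball) simp
    also have "real CARD('p) powi (1 - (int n + 1)) = inverse (real CARD('p)) ^ n"
      by (simp add: power_int_minus power_inverse)
    finally show ?thesis .
  qed
  moreover have lim: "(\<lambda>n. ennreal (inverse (real CARD('p)) ^ n)) \<longlonglongrightarrow> ennreal 0"
    using p by (intro tendsto_ennrealI LIMSEQ_realpow_zero) (simp_all add: inverse_eq_divide)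
  ultimately have "emeasure \<nu> {y} \<le> ennreal 0"
    by (intro LIMSEQ_le_const[OF lim]) blast
  thus "emeasure \<nu> {y} = 0" by simp
qed

sublocale product_prob_space "\<lambda>_ :: nat. \<nu>" UNIV
  by (simp add: product_prob_space_def product_prob_space_axioms_def product_sigma_finite_def
      prob_space_restrict prob_space_imp_sigma_finite)

lemma prob_space_haar_prod: "prob_space (haar_prod \<mu> m)"
  unfolding haar_prod_def by (rule prob_space_PiM) (rule prob_space_restrict)

lemma space_haar_prod: "space (haar_prod \<mu> m) = polydisc m"
  by (simp add: haar_prod_def space_PiM space_restrict polydisc_def)

lemma emeasure_polyball:
  assumes "c \<in> polydisc m" "n \<ge> 1"
  shows "polyball m c n \<in> sets (haar_prod \<mu> m)"
    and "emeasure (haar_prod \<mu> m) (polyball m c n) = ennreal (real CARD('p) powi (1 - n)) ^ m"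
proof -
  have s: "{x. x - c k \<in> padic_ideal n} \<in> sets \<nu>" if "k \<in> {1..m}" for k
    using that assms by (intro emeasure_restrict_ball) (auto simp: polydisc_def)
  show "polyball m c n \<in> sets (haar_prod \<mu> m)"
    unfolding polyball_def haar_prod_def using s by (intro sets_PiM_I_finite) auto
  have "emeasure (haar_prod \<mu> m) (polyball m c n) = (\<Prod>k\<in>{1..m}. emeasure \<nu> {x. x - c k \<in> padic_ideal n})"
    unfolding polyball_def haar_prod_def using s by (intro emeasure_PiM) auto
  also have "\<dots> = (\<Prod>k\<in>{1..m}. ennreal (real CARD('p) powi (1 - n)))"
    using assms by (intro prod.cong refl emeasure_restrict_ball) (auto simp: polydisc_def)
  finally show "emeasure (haar_prod \<mu> m) (polyball m c n) = ennreal (real CARD('p) powi (1 - n)) ^ m"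
    by simp
qed

text \<open>Coordinate preimages of open sets are \<open>polyopen\<close>, hence countable unions of
  polyballs; conversely polyballs are measurable boxes. The polyballs thus become an
  intersection-stable generator on which measures can be compared.\<close>

lemma sets_haar_prod: "sets (haar_prod \<mu> m) = sigma_sets (polydisc m) (polyballs m)"
proof
  let ?S = "sigma (polydisc m) (polyballs m)"
  have "sets (\<Pi>\<^sub>M k\<in>{1..m}. \<nu>) \<subseteq> sets ?S"
  proof (rule sets_PiM_in_sets)
    show "space ?S = (\<Pi>\<^sub>E k\<in>{1..m}. space \<nu>)"
      by (simp add: space_restrict polydisc_def space_measure_of_conv)
    fix k A assume k: "k \<in> {1..m}" and A: "A \<in> sets \<nu>"
    have "(\<lambda>x. x k) \<in> measurable ?S \<mu>"
      unfolding measurable_cong_sets[OF refl sets_haar]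
    proof (rule borel_measurableI)
      fix U :: "'p padic set" assume "open U"
      hence "{x \<in> polydisc m. x k \<in> U} \<in> sigma_sets (polydisc m) (polyballs m)"
        using polyopen_in_sigma polyopen_vimage k by blast
      moreover have "(\<lambda>x. x k) -` U \<inter> space ?S = {x \<in> polydisc m. x k \<in> U}"
        by (auto simp: space_measure_of_conv)
      ultimately show "(\<lambda>x. x k) -` U \<inter> space ?S \<in> sets ?S" by simp
    qed
    hence meas: "(\<lambda>x. x k) \<in> measurable ?S \<nu>"
      using k by (intro measurable_restrict_space2) (auto simp: polydisc_def space_measure_of_conv)
    have "{x \<in> space ?S. x k \<in> A} = (\<lambda>x. x k) -` A \<inter> space ?S" by blast
    thus "{x \<in> space ?S. x k \<in> A} \<in> sets ?S" using measurable_sets[OF meas A] by simp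
  qed
  thus "sets (haar_prod \<mu> m) \<subseteq> sigma_sets (polydisc m) (polyballs m)"
    by (simp add: haar_prod_def)
  have "polyballs m \<subseteq> sets (haar_prod \<mu> m)"
    using emeasure_polyball(1) by (auto simp: polyballs_def)
  thus "sigma_sets (polydisc m) (polyballs m) \<subseteq> sets (haar_prod \<mu> m)"
    using sets.sigma_sets_subset[of "polyballs m" "haar_prod \<mu> m"] by (simp add: space_haar_prod)
qed

lemma polyopen_in_sets: "polyopen m A \<Longrightarrow> A \<in> sets (haar_prod \<mu> m)"
  unfolding sets_haar_prod by (rule polyopen_in_sigma)

end

section \<open>Rational hyperplanes are null sets\<close>

definition hyperplane :: "nat \<Rightarrow> (nat \<Rightarrow> int) \<Rightarrow> (nat \<Rightarrow> 'p::prime_card padic) set" where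
  "hyperplane m c = {x \<in> polydisc m. of_int (c 0) + (\<Sum>k=1..m. of_int (c k) * x k) = 0}"

text \<open>Integers have valuation at least 0, so an integral affine form does not increase
  distances. Near a point where it is nonzero it keeps its valuation and cannot vanish.\<close>

lemma polyopen_compl_hyperplane:
  "polyopen m (polydisc m - (hyperplane m c :: (nat \<Rightarrow> 'p::prime_card padic) set))"
  unfolding polyopen_def
proof (intro conjI ballI)
  fix x :: "nat \<Rightarrow> 'p padic" assume x: "x \<in> polydisc m - hyperplane m c"
  define L :: "(nat \<Rightarrow> 'p padic) \<Rightarrow> 'p padic"
    where "L = (\<lambda>x. of_int (c 0) + (\<Sum>k=1..m. of_int (c k) * x k))"
  define n where "n = max 1 (padic_val (L x) + 1)"
  have L: "L x \<noteq> 0" using x by (simp add: hyperplane_def L_def)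
  have sub: "polyball m x n \<subseteq> polydisc m"
    using x by (intro polyball_subset_polydisc) (auto simp: n_def)
  have "L y \<noteq> 0" if y: "y \<in> polyball m x n" for y
  proof (rule padic_val_eqI(1)[OF L])
    have "L y - L x = (\<Sum>k=1..m. of_int (c k) * (y k - x k))"
      by (simp add: L_def right_diff_distrib sum_subtractf)
    also have "\<dots> \<in> padic_ideal n"
    proof (rule padic_ideal_sum)
      fix k assume "k \<in> {1..m}"
      hence "y k - x k \<in> padic_ideal n" using y by (auto simp: polyball_def)
      thus "of_int (c k) * (y k - x k) \<in> padic_ideal n"
        using padic_ideal_mult[OF of_int_padic_ideal, of "y k - x k" n] by simp
    qed
    finally show "L y - L x \<in> padic_ideal (padic_val (L x) + 1)"
      by (rule padic_ideal_antimono) (simp add: n_def)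
  qed
  hence "polyball m x n \<subseteq> polydisc m - hyperplane m c"
    using sub by (auto simp: hyperplane_def L_def)
  thus "\<exists>n. polyball m x n \<subseteq> polydisc m - hyperplane m c" ..
qed auto

lemma polydisc_minus_D_set':
  "polydisc m - D_set' m =
    (\<Union>c\<in>{c \<in> {..m} \<rightarrow>\<^sub>E UNIV. \<exists>k\<le>m. c k \<noteq> 0}. hyperplane m c :: (nat \<Rightarrow> 'p::prime_card padic) set)"
proof (intro equalityI subsetI)
  fix x :: "nat \<Rightarrow> 'p padic" assume x: "x \<in> polydisc m - D_set' m"
  hence "x \<in> {1..m} \<rightarrow>\<^sub>E UNIV" by (auto simp: polydisc_def PiE_iff)
  then obtain c k where c: "of_int (c 0) + (\<Sum>k=1..m. of_int (c k) * x k) = 0" "k \<le> m" "c k \<noteq> 0"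
    using x by (auto simp: polydisc_def D_set'_def D_set_def)
  \<comment> \<open>Cutting the coefficients off beyond \<open>m\<close> puts them in a countable
    set, so that the union of hyperplanes is countable.\<close>
  define c' where "c' = restrict c {..m}"
  have "of_int (c' 0) + (\<Sum>k=1..m. of_int (c' k) * x k) = 0"
    using c(1) by (simp add: c'_def)
  hence "x \<in> hyperplane m c'" using x by (auto simp: hyperplane_def)
  moreover have "c' \<in> {c \<in> {..m} \<rightarrow>\<^sub>E UNIV. \<exists>k\<le>m. c k \<noteq> 0}"
    using c by (auto simp: c'_def)
  ultimately show "x \<in> (\<Union>c\<in>{c \<in> {..m} \<rightarrow>\<^sub>E UNIV. \<exists>k\<le>m. c k \<noteq> 0}. hyperplane m c)" by blast
qed (auto simp: hyperplane_def D_set'_def D_set_def)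

context padic_haar
begin

text \<open>The first order, with coordinate \<open>j\<close> innermost, serves hyperplanes, which
  meet lines in a point; the second, with coordinate \<open>j\<close> outermost, serves branches,
  whose fibres over \<open>x i\<close> are boxes.\<close>

lemma emeasure_haar_prod_Fubini:
  assumes "j \<in> {1..m}" "A \<in> sets (haar_prod \<mu> m)"
  shows "emeasure (haar_prod \<mu> m) A =
      (\<integral>\<^sup>+x. (\<integral>\<^sup>+y. indicator A (x(j := y)) \<partial>\<nu>) \<partial>(\<Pi>\<^sub>M k\<in>{1..m} - {j}. \<nu>))"
    and "emeasure (haar_prod \<mu> m) A =
      (\<integral>\<^sup>+y. (\<integral>\<^sup>+x. indicator A (x(j := y)) \<partial>(\<Pi>\<^sub>M k\<in>{1..m} - {j}. \<nu>)) \<partial>\<nu>)"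
proof -
  have I: "insert j ({1..m} - {j}) = {1..m}" using assms by blast
  have m: "indicator A \<in> borel_measurable (\<Pi>\<^sub>M k\<in>insert j ({1..m} - {j}). \<nu>)"
    using assms(2) unfolding I haar_prod_def by simp
  have "emeasure (haar_prod \<mu> m) A = (\<integral>\<^sup>+x. indicator A x \<partial>(\<Pi>\<^sub>M k\<in>insert j ({1..m} - {j}). \<nu>))"
    using assms(2) unfolding I haar_prod_def by simp
  thus "emeasure (haar_prod \<mu> m) A =
      (\<integral>\<^sup>+x. (\<integral>\<^sup>+y. indicator A (x(j := y)) \<partial>\<nu>) \<partial>(\<Pi>\<^sub>M k\<in>{1..m} - {j}. \<nu>))"
    and "emeasure (haar_prod \<mu> m) A =
      (\<integral>\<^sup>+y. (\<integral>\<^sup>+x. indicator A (x(j := y)) \<partial>(\<Pi>\<^sub>M k\<in>{1..m} - {j}. \<nu>)) \<partial>\<nu>)"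
    using product_nn_integral_insert[OF _ _ m] product_nn_integral_insert_rev[OF _ _ m] by simp_all
qed

lemma polydisc_in_sets: "polydisc m \<in> sets (haar_prod \<mu> m)"
  using sets.top[of "haar_prod \<mu> m"] by (simp add: space_haar_prod)

lemma hyperplane_in_sets: "hyperplane m c \<in> sets (haar_prod \<mu> m)"
proof -
  have "polydisc m - (polydisc m - hyperplane m c) \<in> sets (haar_prod \<mu> m)"
    by (intro sets.Diff polydisc_in_sets polyopen_in_sets polyopen_compl_hyperplane)
  moreover have "polydisc m - (polydisc m - hyperplane m c) = (hyperplane m c :: (nat \<Rightarrow> 'p padic) set)"
    by (auto simp: hyperplane_def)
  ultimately show ?thesis by simp
qed

text \<open>If \<open>c j\<close> is nonzero for some j \<ge> 1, each line parallel to the j-th axis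
  meets the hyperplane in at most one point \<open>y0\<close>, and points are null.\<close>

lemma hyperplane_null:
  assumes "k \<le> m" "c k \<noteq> 0"
  shows "emeasure (haar_prod \<mu> m) (hyperplane m c) = 0"
proof (cases "\<exists>j\<in>{1..m}. c j \<noteq> 0")
  \<comment> \<open>Only \<open>c 0\<close> can then be nonzero, and the equation has no
    solution.\<close>
  case False
  hence "hyperplane m c = ({} :: (nat \<Rightarrow> 'p padic) set)"
    using assms by (cases k) (auto simp: hyperplane_def)
  thus ?thesis by simp
next
  case True
  then obtain j where j: "j \<in> {1..m}" "c j \<noteq> 0" by blast
  have "(\<integral>\<^sup>+y. indicator (hyperplane m c) (x(j := y)) \<partial>\<nu>) = 0" for x
  proof -
    define y0 where "y0 = - (of_int (c 0) + (\<Sum>k\<in>{1..m}-{j}. of_int (c k) * x k)) / of_int (c j)"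
    have "y = y0" if "x(j := y) \<in> hyperplane m c" for y
    proof -
      have "(\<Sum>k=1..m. of_int (c k) * (x(j := y)) k) =
          of_int (c j) * y + (\<Sum>k\<in>{1..m}-{j}. of_int (c k) * (x(j := y)) k)"
        using j(1) by (subst sum.remove[of _ j]) auto
      also have "(\<Sum>k\<in>{1..m}-{j}. of_int (c k) * (x(j := y)) k) =
          (\<Sum>k\<in>{1..m}-{j}. of_int (c k) * x k)"
        by (rule sum.cong) auto
      finally have "of_int (c 0) + (of_int (c j) * y + (\<Sum>k\<in>{1..m}-{j}. of_int (c k) * x k)) = 0"
        using that j(1) by (simp add: hyperplane_def)
      hence "of_int (c j) * y = - (of_int (c 0) + (\<Sum>k\<in>{1..m}-{j}. of_int (c k) * x k))"
        unfolding eq_neg_iff_add_eq_0 by (simp only: add_ac)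
      thus ?thesis using j(2) by (simp add: y0_def eq_divide_eq mult.commute)
    qed
    hence "(\<integral>\<^sup>+y. indicator (hyperplane m c) (x(j := y)) \<partial>\<nu>) \<le> (\<integral>\<^sup>+y. indicator ({y0} \<inter> pZp) y \<partial>\<nu>)"
      by (intro nn_integral_mono) (simp add: space_restrict indicator_def)
    also have "\<dots> = 0"
      using emeasure_restrict_singleton[of y0] by (cases "y0 \<in> pZp") simp_all
    finally show ?thesis by simp
  qed
  thus ?thesis by (simp add: emeasure_haar_prod_Fubini(1)[OF j(1) hyperplane_in_sets])
qed

lemma D_set'_full:
  "D_set' m \<in> sets (haar_prod \<mu> m)" "emeasure (haar_prod \<mu> m) (D_set' m) = 1"
proof -
  let ?C = "{c \<in> {..m} \<rightarrow>\<^sub>E (UNIV :: int set). \<exists>k\<le>m. c k \<noteq> 0}"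
  have "countable ?C"
    by (rule countable_subset[OF _ countable_PiE[of "{..m}" "\<lambda>_. UNIV :: int set"]]) auto
  moreover have "hyperplane m c \<in> null_sets (haar_prod \<mu> m)" if "c \<in> ?C" for c
    using that hyperplane_null hyperplane_in_sets by (intro null_setsI) auto
  ultimately have "(\<Union>c\<in>?C. hyperplane m c) \<in> null_sets (haar_prod \<mu> m)"
    by (rule null_sets_UN')
  hence null: "polydisc m - D_set' m \<in> null_sets (haar_prod \<mu> m)"
    unfolding polydisc_minus_D_set' .
  have D: "D_set' m = polydisc m - (polydisc m - D_set' m)"
    by (auto simp: D_set'_def polydisc_def)
  show "D_set' m \<in> sets (haar_prod \<mu> m)"
    by (subst D) (intro sets.Diff polydisc_in_sets null_setsD2 null)
  show "emeasure (haar_prod \<mu> m) (D_set' m) = 1"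
    using prob_space.emeasure_space_1[OF prob_space_haar_prod] emeasure_Diff_null_set[OF null polydisc_in_sets]
    by (subst D) (simp add: space_haar_prod)
qed

end

section \<open>Branches\<close>

text \<open>Inversion carries balls to balls: a/t - d = (d/t) (a/d - t). Either side of the
  equivalence puts \<open>t\<close> so close to a/d, or a/t so close to \<open>d\<close>, that the
  valuation of \<open>t\<close> is forced; then d/t has the constant valuation 2 val d - val a,
  which is the shift of the level.\<close>

lemma inversion_ball_iff:
  assumes "a \<noteq> 0" "d \<noteq> 0" "padic_val d < n"
  shows "t \<noteq> 0 \<and> a / t - d \<in> padic_ideal n \<longleftrightarrow>
      t - a / d \<in> padic_ideal (n + padic_val a - 2 * padic_val d)"
    and "t - a / d \<in> padic_ideal (n + padic_val a - 2 * padic_val d) \<Longrightarrow>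
      padic_val t = padic_val a - padic_val d"
proof -
  have ad: "a / d \<noteq> 0" "padic_val (a / d) = padic_val a - padic_val d"
    using assms by (simp_all add: padic_val_divide)
  have fwd: "t \<noteq> 0 \<and> padic_val t = padic_val a - padic_val d"
    if "t - a / d \<in> padic_ideal (n + padic_val a - 2 * padic_val d)"
  proof -
    have "t - a / d \<in> padic_ideal (padic_val (a / d) + 1)"
      using that assms(3) by (rule_tac padic_ideal_antimono) (auto simp: ad)
    from padic_val_eqI[OF ad(1) this] show ?thesis using ad by simp
  qed
  thus "t - a / d \<in> padic_ideal (n + padic_val a - 2 * padic_val d) \<Longrightarrow>
      padic_val t = padic_val a - padic_val d" by blast
  have bwd: "padic_val t = padic_val a - padic_val d" if t: "t \<noteq> 0" "a / t - d \<in> padic_ideal n"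
  proof -
    have "a / t - d \<in> padic_ideal (padic_val d + 1)"
      using that assms(3) by (rule_tac padic_ideal_antimono) auto
    from padic_val_eqI(2)[OF assms(2) this] show ?thesis using t assms by (simp add: padic_val_divide)
  qed
  have eq: "a / t - d \<in> padic_ideal n \<longleftrightarrow>
      t - a / d \<in> padic_ideal (n + padic_val a - 2 * padic_val d)"
    if t: "t \<noteq> 0" "padic_val t = padic_val a - padic_val d"
  proof -
    have "a / t - d = (d / t) * (a / d - t)" using t assms by (simp add: field_simps)
    moreover have "n - padic_val (d / t) = n + padic_val a - 2 * padic_val d"
      using t assms by (simp add: padic_val_divide)
    moreover have "d / t \<noteq> 0" using t assms by simp
    ultimately have "a / t - d \<in> padic_ideal n \<longleftrightarrow>
        a / d - t \<in> padic_ideal (n + padic_val a - 2 * padic_val d)"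
      using padic_ideal_mult_iff[of "d / t" "a / d - t" n] by presburger
    thus ?thesis unfolding padic_ideal_commute[of t] .
  qed
  show "t \<noteq> 0 \<and> a / t - d \<in> padic_ideal n \<longleftrightarrow>
      t - a / d \<in> padic_ideal (n + padic_val a - 2 * padic_val d)"
    using fwd bwd eq by blast
qed

text \<open>The hyperbolicity conditions rewritten for the integer valued \<open>padic_val\<close>, with
  \<open>e\<close> the valuation of \<open>a s / b s\<close>; the last two merge conditions (iii) and (iv).\<close>

locale hyperbolic_branch =
  fixes m i s :: nat and \<sigma> :: "nat \<Rightarrow> nat" and a b :: "nat \<Rightarrow> 'p::prime_card padic" and e :: int
  assumes s: "s \<in> {1..m}" and perm: "\<sigma> permutes {1..m}" and \<sigma>_s: "\<sigma> s = i"
    and a_nz: "\<And>k. k \<in> {1..m} \<Longrightarrow> a k \<noteq> 0"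
    and a_val: "\<And>k. k \<in> {1..m} \<Longrightarrow> padic_val (a k) \<ge> 0"
    and b_nz: "b s \<noteq> 0" and b_val: "padic_val (b s) \<le> 0"
    and e: "e = padic_val (a s) - padic_val (b s)" and e_pos: "e \<ge> 1"
    and a_less: "\<And>k. k \<in> {1..m} - {s} \<Longrightarrow> padic_val (a k) < e"
    and b_ideal: "\<And>k. k \<in> {1..m} - {s} \<Longrightarrow> b k \<in> padic_ideal (1 + padic_val (a k) - e)"
begin

definition branch :: "(nat \<Rightarrow> 'p padic) \<Rightarrow> nat \<Rightarrow> 'p padic" where
  "branch x = (\<lambda>k\<in>{1..m}. if k = s then a k / x i - b k else a k * x (\<sigma> k) / x i - b k)"

text \<open>Taken in the whole polydisc, where \<open>x i\<close> may vanish. That case has to be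
  excluded explicitly, since division by 0 yields 0 and \<open>branch x\<close> would be a
  meaningless constant.\<close>

definition pre :: "(nat \<Rightarrow> 'p padic) set \<Rightarrow> (nat \<Rightarrow> 'p padic) set" where
  "pre A = {x \<in> polydisc m. x i \<noteq> 0 \<and> branch x \<in> A}"

definition slope :: "(nat \<Rightarrow> 'p padic) \<Rightarrow> nat \<Rightarrow> 'p padic" where
  "slope c k = (b k + c k) / a k"

lemma i: "i \<in> {1..m}"
  using permutes_in_image[OF perm] s \<sigma>_s by metis

text \<open>\<open>b s\<close> dominates \<open>c s\<close>, whose valuation is at least 1. The
  inverse branch therefore never divides by zero, and the coordinate \<open>x i\<close> it produces
  always has valuation \<open>e\<close>.\<close>

lemma denominator:
  assumes "c \<in> polydisc m"
  shows "b s + c s \<noteq> 0" "padic_val (b s + c s) = padic_val (b s)"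
proof -
  have "b s + c s - b s \<in> padic_ideal 1" using assms s by (auto simp: polydisc_def pZp_eq)
  hence "b s + c s - b s \<in> padic_ideal (padic_val (b s) + 1)"
    by (rule padic_ideal_antimono) (use b_val in simp)
  from padic_val_eqI[OF b_nz this] show "b s + c s \<noteq> 0" "padic_val (b s + c s) = padic_val (b s)"
    by auto
qed

text \<open>Multiplied by \<open>x i\<close>, of valuation \<open>e\<close>, the slope lands in p
  Z_p: the inverse branch stays in the polydisc. The shape of \<open>b_ideal\<close> is made for
  this bound.\<close>

lemma slope_ideal:
  assumes "c \<in> polydisc m" "k \<in> {1..m} - {s}"
  shows "slope c k \<in> padic_ideal (1 - e)"
proof -
  have "c k \<in> padic_ideal 1" using assms by (auto simp: polydisc_def pZp_eq)
  hence "c k \<in> padic_ideal (1 + padic_val (a k) - e)"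
    by (rule padic_ideal_antimono) (use a_less[OF assms(2)] in simp)
  hence "b k + c k \<in> padic_ideal (1 + padic_val (a k) - e)"
    using b_ideal[OF assms(2)] by (rule_tac padic_ideal_add)
  thus ?thesis using assms a_nz by (simp add: slope_def padic_ideal_divide_iff algebra_simps)
qed

text \<open>The inverse branch sends \<open>y\<close> to the point with \<open>x i = a s / (b s + y s)\<close> and
  \<open>x (\<sigma> k) = x i * slope y k\<close>; the preimage of a polyball is thus fibred over a ball of values
  of \<open>x i\<close> with boxes as fibres.\<close>

lemma pre_polyball_iff:
  assumes c: "c \<in> polydisc m" and n: "n \<ge> 1" and x: "x \<in> polydisc m"
  shows "x \<in> pre (polyball m c n) \<longleftrightarrow>
      x i - a s / (b s + c s) \<in> padic_ideal (n + e - padic_val (b s)) \<and>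
      (\<forall>k\<in>{1..m}-{s}. x (\<sigma> k) - x i * slope c k \<in> padic_ideal (n + e - padic_val (a k)))"
    (is "_ \<longleftrightarrow> ?B \<and> ?R")
proof -
  let ?d = "b s + c s"
  have d: "?d \<noteq> 0" "padic_val ?d = padic_val (b s)" using denominator[OF c] by auto
  have less: "padic_val ?d < n" using d b_val n by simp
  have ex: "n + e - padic_val (b s) = n + padic_val (a s) - 2 * padic_val ?d"
    using d e by simp
  have B: "x i \<noteq> 0 \<and> a s / x i - ?d \<in> padic_ideal n \<longleftrightarrow> ?B"
    unfolding ex by (rule inversion_ball_iff(1)) (use a_nz s d less in auto)
  \<comment> \<open>The condition on \<open>x i\<close> alone fixes its valuation, so multiplying by
    \<open>a k\<close> and dividing by \<open>x i\<close> merely shift the level by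
    \<open>e - padic_val (a k)\<close>.\<close>
  have val: "padic_val (x i) = e" if ?B
    using inversion_ball_iff(2)[OF a_nz[OF s] d(1) less, of "x i"] that ex e d by simp
  have R: "a k * x (\<sigma> k) / x i - b k - c k \<in> padic_ideal n \<longleftrightarrow>
      x (\<sigma> k) - x i * slope c k \<in> padic_ideal (n + e - padic_val (a k))"
    if ?B "k \<in> {1..m} - {s}" for k
  proof -
    have nz: "x i \<noteq> 0" "a k \<noteq> 0" using that B a_nz by auto
    hence "a k * x (\<sigma> k) / x i - b k - c k = a k * (x (\<sigma> k) - x i * slope c k) / x i"
      by (simp add: slope_def field_simps)
    thus ?thesis using nz val[OF that(1)]
      by (simp add: padic_ideal_divide_iff padic_ideal_mult_iff)
  qed
  have "branch x \<in> polyball m c n \<longleftrightarrow> (\<forall>k\<in>{1..m}. branch x k - c k \<in> padic_ideal n)"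
    by (auto simp: polyball_def branch_def PiE_iff)
  also have "\<dots> \<longleftrightarrow> branch x s - c s \<in> padic_ideal n \<and>
      (\<forall>k\<in>{1..m}-{s}. branch x k - c k \<in> padic_ideal n)"
    using s by blast
  also have "\<dots> \<longleftrightarrow> a s / x i - ?d \<in> padic_ideal n \<and>
      (\<forall>k\<in>{1..m}-{s}. a k * x (\<sigma> k) / x i - b k - c k \<in> padic_ideal n)"
    using s by (simp add: branch_def diff_diff_eq)
  finally have "x \<in> pre (polyball m c n) \<longleftrightarrow> (x i \<noteq> 0 \<and> a s / x i - ?d \<in> padic_ideal n) \<and>
      (\<forall>k\<in>{1..m}-{s}. a k * x (\<sigma> k) / x i - b k - c k \<in> padic_ideal n)"
    using x unfolding pre_def by blast
  thus ?thesis unfolding B using R by blast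
qed

lemma polyopen_pre:
  assumes c: "c \<in> polydisc m" and n: "n \<ge> 1"
  shows "polyopen m (pre (polyball m c n))"
  unfolding polyopen_def
proof (intro conjI ballI)
  fix x assume x: "x \<in> pre (polyball m c n)"
  hence xd: "x \<in> polydisc m" by (simp add: pre_def)
  \<comment> \<open>One \<open>e\<close> covers the levels in \<open>pre_polyball_iff\<close>; the
    second compensates the slope, which may have valuation as low as 1 - e. Subtracting
    \<open>padic_val (b s)\<close> covers the condition on \<open>x i\<close>.\<close>
  define N where "N = n + 2 * e - padic_val (b s)"
  have N: "N \<ge> 1" using n e_pos b_val by (simp add: N_def)
  have "y \<in> pre (polyball m c n)" if y: "y \<in> polyball m x N" for y
  proof -
    have yd: "y \<in> polydisc m" using polyball_subset_polydisc[OF xd N] y by blast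
    have yx: "y k - x k \<in> padic_ideal N" if "k \<in> {1..m}" for k
      using y that by (auto simp: polyball_def)
    note xB = x[unfolded pre_polyball_iff[OF c n xd]]
    have "y i - a s / (b s + c s) \<in> padic_ideal (n + e - padic_val (b s))"
    proof (rule padic_ideal_trans)
      show "y i - x i \<in> padic_ideal (n + e - padic_val (b s))"
        using yx[OF i] by (rule padic_ideal_antimono) (use e_pos in \<open>simp add: N_def\<close>)
    qed (use xB in simp)
    moreover have "y (\<sigma> k) - y i * slope c k \<in> padic_ideal (n + e - padic_val (a k))"
      if k: "k \<in> {1..m} - {s}" for k
    proof -
      have \<sigma>k: "\<sigma> k \<in> {1..m}" using permutes_in_image[OF perm] k by blast
      have "y (\<sigma> k) - x (\<sigma> k) \<in> padic_ideal (n + e - padic_val (a k))"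
        using yx[OF \<sigma>k] by (rule padic_ideal_antimono)
          (use e_pos b_val a_val[of k] k in \<open>simp add: N_def\<close>)
      moreover have "(y i - x i) * slope c k \<in> padic_ideal (n + e - padic_val (a k))"
        using padic_ideal_mult[OF yx[OF i] slope_ideal[OF c k]] by (rule padic_ideal_antimono)
          (use e_pos b_val a_val[of k] k in \<open>simp add: N_def\<close>)
      ultimately have "(y (\<sigma> k) - x (\<sigma> k)) - (y i - x i) * slope c k
          \<in> padic_ideal (n + e - padic_val (a k))"
        by (rule padic_ideal_diff)
      moreover have "x (\<sigma> k) - x i * slope c k \<in> padic_ideal (n + e - padic_val (a k))"
        using xB k by blast
      ultimately have "(y (\<sigma> k) - x (\<sigma> k)) - (y i - x i) * slope c k + (x (\<sigma> k) - x i * slope c k)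
          \<in> padic_ideal (n + e - padic_val (a k))"
        by (rule padic_ideal_add)
      moreover have "(y (\<sigma> k) - x (\<sigma> k)) - (y i - x i) * slope c k + (x (\<sigma> k) - x i * slope c k)
          = y (\<sigma> k) - y i * slope c k" by (simp add: algebra_simps)
      ultimately show ?thesis by metis
    qed
    ultimately show ?thesis unfolding pre_polyball_iff[OF c n yd] by blast
  qed
  thus "\<exists>n'. polyball m x n' \<subseteq> pre (polyball m c n)" by blast
qed (auto simp: pre_def)

text \<open>Both points satisfy the congruences of \<open>pre_polyball_iff\<close> for the common
  centre \<open>branch x\<close>. The differences e - val (b s) and e - val (a k) are at least 1,
  which is the gained level. The cross term (y i - x i) * slope has level at least (n + e - val (b
  s)) + (1 - e), again at least n + 1.\<close>

lemma branch_expanding: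
  assumes x: "x \<in> pre (polydisc m)" and y: "y \<in> pre (polydisc m)" and n: "n \<ge> 1"
    and xy: "branch y \<in> polyball m (branch x) n"
  shows "y \<in> polyball m x (n + 1)"
proof -
  define c where "c = branch x"
  have c: "c \<in> polydisc m" and d: "x \<in> polydisc m" "y \<in> polydisc m"
    using x y by (auto simp: pre_def c_def)
  have "branch x \<in> polyball m c n" using polyball_center c by (simp add: c_def)
  hence "x \<in> pre (polyball m c n)" "y \<in> pre (polyball m c n)"
    using x y xy by (auto simp: pre_def c_def)
  note B = this[unfolded pre_polyball_iff[OF c n d(1)] pre_polyball_iff[OF c n d(2)]]
  have yx: "y i - x i \<in> padic_ideal (n + e - padic_val (b s))"
    using B padic_ideal_trans padic_ideal_commute by blast
  have "y j - x j \<in> padic_ideal (n + 1)" if j: "j \<in> {1..m}" for j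
  proof (cases "j = i")
    case True
    have "y i - x i \<in> padic_ideal (n + 1)"
      using yx by (rule padic_ideal_antimono) (use e_pos b_val in simp)
    thus ?thesis using True by simp
  next
    case False
    obtain k where k: "j = \<sigma> k" "k \<in> {1..m} - {s}"
    proof
      show "j = \<sigma> (inv \<sigma> j)" using permutes_inverses(1)[OF perm] by metis
      thus "inv \<sigma> j \<in> {1..m} - {s}"
        using permutes_in_image[OF permutes_inv[OF perm]] j False \<sigma>_s by (metis DiffI singletonD)
    qed
    have ak: "n + 1 \<le> n + e - padic_val (a k)" using a_less[OF k(2)] by simp
    have 1: "y j - y i * slope c k \<in> padic_ideal (n + 1)" "x j - x i * slope c k \<in> padic_ideal (n + 1)"
      using B k(2) unfolding k(1) by (blast intro: padic_ideal_antimono[OF _ ak])+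
    have 2: "(y i - x i) * slope c k \<in> padic_ideal (n + 1)"
      using padic_ideal_mult[OF yx slope_ideal[OF c k(2)]]
      by (rule padic_ideal_antimono) (use b_val in simp)
    have "y j - x j = (y j - y i * slope c k) - (x j - x i * slope c k) + (y i - x i) * slope c k"
      by (simp add: algebra_simps)
    thus ?thesis using padic_ideal_add[OF padic_ideal_diff[OF 1] 2] by metis
  qed
  thus ?thesis using d by (auto simp: polyball_def polydisc_def PiE_iff)
qed

end

section \<open>Change of variables under a branch\<close>

locale hyperbolic_branch_haar = padic_haar \<mu> + hyperbolic_branch m i s \<sigma> a b e
  for \<mu> :: "'p::prime_card padic measure" and m i s \<sigma> and a b :: "nat \<Rightarrow> 'p padic" and e
begin

text \<open>The absolute value of the Jacobian of the inverse branch. Its diagonal derivatives are -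
  a s / (b s + y s)^2, of valuation e - val (b s), and x i / a k, of valuation e - val (a
  k).\<close>

definition scaling :: ennreal where
  "scaling = ennreal (real CARD('p) powi (padic_val (b s) - e)) *
     (\<Prod>k\<in>{1..m}-{s}. ennreal (real CARD('p) powi (padic_val (a k) - e)))"

text \<open>Integrate over t = x i last. As \<open>t\<close> varies in the ball \<open>B\<close>,
  only the centres of the box \<open>R t\<close> move while its radii stay fixed, so all fibres have
  the same measure \<open>K\<close>.\<close>

lemma emeasure_pre_polyball:
  assumes c: "c \<in> polydisc m" and n: "n \<ge> 1"
  shows "emeasure (haar_prod \<mu> m) (pre (polyball m c n)) =
    scaling * emeasure (haar_prod \<mu> m) (polyball m c n)"
proof -
  let ?I = "{1..m} - {i}" and ?q = "\<lambda>n. ennreal (real CARD('p) powi n)"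
  define \<tau> where "\<tau> = inv \<sigma>"
  have \<tau>: "bij_betw \<tau> ?I ({1..m} - {s})"
  proof (rule bij_betwI[where g = \<sigma>])
    show "\<tau> \<in> ?I \<rightarrow> {1..m} - {s}"
      using permutes_in_image[OF permutes_inv[OF perm]] permutes_inverses(1)[OF perm] \<sigma>_s
      by (auto simp: \<tau>_def)
    show "\<sigma> \<in> {1..m} - {s} \<rightarrow> ?I"
      using permutes_in_image[OF perm] permutes_inverses(2)[OF perm] \<sigma>_s by (auto; metis)
  qed (use permutes_inverses[OF perm] in \<open>simp_all add: \<tau>_def\<close>)
  have \<tau>I: "\<tau> j \<in> {1..m} - {s}" "\<sigma> (\<tau> j) = j" if "j \<in> ?I" for j
    using that \<tau> permutes_inverses(1)[OF perm] by (auto simp: bij_betw_def \<tau>_def)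
  define B where "B = {t. t - a s / (b s + c s) \<in> padic_ideal (n + e - padic_val (b s))}"
  define R where "R = (\<lambda>t. \<Pi>\<^sub>E j\<in>?I.
    {y. y - t * slope c (\<tau> j) \<in> padic_ideal (n + e - padic_val (a (\<tau> j)))})"
  have center: "a s / (b s + c s) \<in> padic_ideal e"
    using denominator[OF c] e a_nz[OF s]
    by (simp add: padic_ideal_iff padic_val_divide)
  have centerZ: "a s / (b s + c s) \<in> pZp"
    unfolding pZp_eq using center e_pos by (rule padic_ideal_antimono)
  have nb: "n + e - padic_val (b s) \<ge> 1" using n e_pos b_val by simp
  have B_ideal: "t \<in> padic_ideal e" if "t \<in> B" for t
  proof -
    have "t - a s / (b s + c s) \<in> padic_ideal e"
      using that unfolding B_def mem_Collect_eq by (rule padic_ideal_antimono) (use n b_val in simp)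
    thus ?thesis using padic_ideal_add[OF _ center] by fastforce
  qed
  have mem: "x(i := t) \<in> pre (polyball m c n) \<longleftrightarrow> t \<in> B \<and> x \<in> R t"
    if x: "x \<in> ?I \<rightarrow>\<^sub>E pZp" and t: "t \<in> pZp" for x t
  proof -
    have xt: "x(i := t) \<in> polydisc m"
      using x t i by (auto simp: polydisc_def PiE_iff extensional_def)
    have "x \<in> R t \<longleftrightarrow> (\<forall>j\<in>?I. x j - t * slope c (\<tau> j) \<in> padic_ideal (n + e - padic_val (a (\<tau> j))))"
      using x by (auto simp: R_def PiE_iff)
    also have "\<dots> \<longleftrightarrow> (\<forall>k\<in>\<tau> ` ?I. x (\<sigma> k) - t * slope c k \<in> padic_ideal (n + e - padic_val (a k)))"
      using \<tau>I(2) by simp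
    also have "\<tau> ` ?I = {1..m} - {s}" using \<tau> by (simp add: bij_betw_def)
    also have "(\<forall>k\<in>{1..m} - {s}. x (\<sigma> k) - t * slope c k \<in> padic_ideal (n + e - padic_val (a k))) \<longleftrightarrow>
      (\<forall>k\<in>{1..m} - {s}. (x(i := t)) (\<sigma> k) - t * slope c k \<in> padic_ideal (n + e - padic_val (a k)))"
    proof (rule ball_cong[OF refl])
      fix k assume "k \<in> {1..m} - {s}"
      hence "\<sigma> k \<noteq> i" using permutes_inverses(2)[OF perm] \<sigma>_s by (metis DiffD2 singletonI)
      thus "(x (\<sigma> k) - t * slope c k \<in> padic_ideal (n + e - padic_val (a k))) =
        ((x(i := t)) (\<sigma> k) - t * slope c k \<in> padic_ideal (n + e - padic_val (a k)))" by simp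
    qed
    finally show ?thesis
      unfolding pre_polyball_iff[OF c n xt] B_def by simp
  qed
  have R: "R t \<in> sets (\<Pi>\<^sub>M k\<in>?I. \<nu>)"
    "emeasure (\<Pi>\<^sub>M k\<in>?I. \<nu>) (R t) = (\<Prod>j\<in>?I. ?q (1 - (n + e - padic_val (a (\<tau> j)))))"
    if t: "t \<in> B" for t
  proof -
    \<comment> \<open>The centres lie in p Z_p and the levels are at least 1, so each factor of the
      box is a full ball of Q_p and is not truncated by the restriction to p Z_p.\<close>
    have Z: "t * slope c (\<tau> j) \<in> pZp" and ge: "n + e - padic_val (a (\<tau> j)) \<ge> 1" if "j \<in> ?I" for j
    proof -
      show "t * slope c (\<tau> j) \<in> pZp"
        using padic_ideal_mult[OF B_ideal[OF t] slope_ideal[OF c \<tau>I(1)[OF that]]]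
        by (simp add: pZp_eq)
      show "n + e - padic_val (a (\<tau> j)) \<ge> 1" using a_less[OF \<tau>I(1)[OF that]] n by simp
    qed
    note ball = emeasure_restrict_ball[OF Z ge]
    show "R t \<in> sets (\<Pi>\<^sub>M k\<in>?I. \<nu>)"
      unfolding R_def using ball(1) by (intro sets_PiM_I_finite) auto
    have "emeasure (\<Pi>\<^sub>M k\<in>?I. \<nu>) (R t) = (\<Prod>j\<in>?I. emeasure \<nu>
        {y. y - t * slope c (\<tau> j) \<in> padic_ideal (n + e - padic_val (a (\<tau> j)))})"
      unfolding R_def using ball(1) by (intro emeasure_PiM) auto
    also have "\<dots> = (\<Prod>j\<in>?I. ?q (1 - (n + e - padic_val (a (\<tau> j)))))"
      by (rule prod.cong[OF refl ball(2)])
    finally show "emeasure (\<Pi>\<^sub>M k\<in>?I. \<nu>) (R t) =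
      (\<Prod>j\<in>?I. ?q (1 - (n + e - padic_val (a (\<tau> j)))))" .
  qed
  define K where "K = (\<Prod>j\<in>?I. ?q (1 - (n + e - padic_val (a (\<tau> j)))))"
  have inner: "(\<integral>\<^sup>+x. indicator (pre (polyball m c n)) (x(i := t)) \<partial>(\<Pi>\<^sub>M k\<in>?I. \<nu>)) = K * indicator B t"
    if t: "t \<in> space \<nu>" for t
  proof -
    have "(\<integral>\<^sup>+x. indicator (pre (polyball m c n)) (x(i := t)) \<partial>(\<Pi>\<^sub>M k\<in>?I. \<nu>)) =
        (\<integral>\<^sup>+x. indicator B t * indicator (R t) x \<partial>(\<Pi>\<^sub>M k\<in>?I. \<nu>))"
      using mem t by (intro nn_integral_cong) (simp add: space_PiM space_restrict indicator_def)
    also have "\<dots> = K * indicator B t"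
      using R[of t] by (cases "t \<in> B") (simp_all add: K_def)
    finally show ?thesis .
  qed
  have pre_sets: "pre (polyball m c n) \<in> sets (haar_prod \<mu> m)"
    using polyopen_in_sets polyopen_pre c n by blast
  have q_add: "?q (j + k) = ?q j * ?q k" for j k
    by (simp add: power_int_add ennreal_mult)
  have "emeasure (haar_prod \<mu> m) (pre (polyball m c n)) = (\<integral>\<^sup>+t. K * indicator B t \<partial>\<nu>)"
    unfolding emeasure_haar_prod_Fubini(2)[OF i pre_sets] by (rule nn_integral_cong) (rule inner)
  also have "\<dots> = K * emeasure \<nu> B"
    using emeasure_restrict_ball(1)[OF centerZ nb]
    by (intro nn_integral_cmult_indicator) (simp add: B_def)
  also have "emeasure \<nu> B = ?q (1 - (n + e - padic_val (b s)))"
    unfolding B_def by (rule emeasure_restrict_ball(2)[OF centerZ nb])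
  \<comment> \<open>Each of the \<open>m\<close> exponents splits into 1 - n and a constant of the
    branch. The \<open>m\<close> factors p^(1 - n) recombine to the measure of the polyball, the
    rest to \<open>scaling\<close>.\<close>
  also have "1 - (n + e - padic_val (b s)) = (1 - n) + (padic_val (b s) - e)" by simp
  also have "?q \<dots> = ?q (1 - n) * ?q (padic_val (b s) - e)" by (rule q_add)
  also have "K = (\<Prod>k\<in>{1..m}-{s}. ?q (1 - (n + e - padic_val (a k))))"
    unfolding K_def by (rule prod.reindex_bij_betw[OF \<tau>])
  also have "\<dots> = (\<Prod>k\<in>{1..m}-{s}. ?q (1 - n) * ?q (padic_val (a k) - e))"
  proof (rule prod.cong[OF refl])
    fix k
    have "1 - (n + e - padic_val (a k)) = (1 - n) + (padic_val (a k) - e)" by simp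
    thus "?q (1 - (n + e - padic_val (a k))) = ?q (1 - n) * ?q (padic_val (a k) - e)"
      by (simp only: q_add)
  qed
  also have "\<dots> = ?q (1 - n) ^ (m - 1) * (\<Prod>k\<in>{1..m}-{s}. ?q (padic_val (a k) - e))"
    using s by (simp add: prod.distrib)
  also have "\<dots> * (?q (1 - n) * ?q (padic_val (b s) - e)) = scaling * (?q (1 - n) * ?q (1 - n) ^ (m - 1))"
    unfolding scaling_def by (simp only: mult_ac)
  also have "?q (1 - n) * ?q (1 - n) ^ (m - 1) = emeasure (haar_prod \<mu> m) (polyball m c n)"
    unfolding emeasure_polyball(2)[OF c n] power_Suc[symmetric] using s by simp
  finally show ?thesis .
qed

text \<open>The image under \<open>branch\<close> of the measure on its domain \<open>C\<close> and
  the scaled product measure are finite and agree on polyballs, hence on everything these generate.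
  Measurability of \<open>branch\<close> is likewise checked on polyballs.\<close>

lemma emeasure_pre:
  assumes A: "A \<in> sets (haar_prod \<mu> m)"
  shows "pre A \<in> sets (haar_prod \<mu> m)"
    and "emeasure (haar_prod \<mu> m) (pre A) = scaling * emeasure (haar_prod \<mu> m) A"
proof -
  let ?M = "haar_prod \<mu> m"
  define C where "C = pre (polydisc m)"
  have pre: "pre X \<in> sets ?M" if "X \<in> polyballs m" for X
    using that polyopen_in_sets polyopen_pre by (auto simp: polyballs_def pre_def)
  have C: "C \<in> sets ?M" unfolding C_def using polydisc_in_polyballs by (rule pre)
  have C_sub: "C \<subseteq> polydisc m" by (auto simp: C_def pre_def)
  have vimage: "branch -` X \<inter> C = pre X" if "X \<subseteq> polydisc m" for X
    using that by (auto simp: C_def pre_def)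
  define R where "R = restrict_space ?M C"
  have space_R: "space R = C"
    using C_sub by (auto simp: R_def space_restrict_space space_haar_prod)
  have sets_R: "X \<in> sets R \<longleftrightarrow> X \<subseteq> C \<and> X \<in> sets ?M" for X
    using C by (simp add: R_def sets_restrict_space_iff)
  have pre_sub: "pre X \<subseteq> C" if "X \<subseteq> polydisc m" for X
    using that by (auto simp: C_def pre_def)
  have meas: "branch \<in> measurable R ?M"
  proof (rule measurable_sigma_sets[OF sets_haar_prod polyballs_subset])
    show "branch \<in> space R \<rightarrow> polydisc m" by (auto simp: space_R C_def pre_def)
    fix X :: "(nat \<Rightarrow> 'p padic) set" assume X: "X \<in> polyballs m"
    hence "X \<subseteq> polydisc m" using polyballs_subset by blast
    thus "branch -` X \<inter> space R \<in> sets R"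
      unfolding space_R sets_R using X pre pre_sub vimage by simp
  qed
  have sub: "X \<subseteq> polydisc m" if "X \<in> sets ?M" for X
    using sets.sets_into_space[OF that] by (simp add: space_haar_prod)
  have pre_sets: "pre X \<in> sets ?M" if "X \<in> sets ?M" for X
    using measurable_sets[OF meas that] vimage[OF sub[OF that]] by (simp add: space_R sets_R)
  have distr: "emeasure (distr R ?M branch) X = emeasure ?M (pre X)" if "X \<in> sets ?M" for X
    using that vimage[OF sub[OF that]] pre_sub[OF sub[OF that]] C C_sub
    by (subst emeasure_distr[OF meas])
      (simp_all add: space_R, simp add: R_def emeasure_restrict_space space_haar_prod Int_absorb2)
  have "distr R ?M branch = scale_measure scaling ?M"
  proof (rule measure_eqI_generator_eq[OF Int_stable_polyballs polyballs_subset])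
    fix X :: "(nat \<Rightarrow> 'p padic) set" assume X: "X \<in> polyballs m"
    hence "X \<in> sets ?M" unfolding sets_haar_prod by (rule sigma_sets.Basic)
    moreover have "emeasure ?M (pre X) = scaling * emeasure ?M X"
      using X emeasure_pre_polyball by (auto simp: polyballs_def pre_def)
    ultimately show "emeasure (distr R ?M branch) X = emeasure (scale_measure scaling ?M) X"
      by (simp add: distr)
  next
    have "emeasure ?M C < \<infinity>"
      using prob_space.emeasure_le_1[OF prob_space_haar_prod, of m C] by (simp add: order_le_less_trans)
    thus "emeasure (distr R ?M branch) (polydisc m) \<noteq> \<infinity>" 
      by (simp add: distr polydisc_in_sets C_def)
  qed (use polydisc_in_polyballs in \<open>auto simp: sets_haar_prod\<close>)
  thus "emeasure ?M (pre A) = scaling * emeasure ?M A"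
    using distr[OF A] by simp
  show "pre A \<in> sets ?M" using A by (rule pre_sets)
qed

end

section \<open>Cylinders of hyperbolic transformations\<close>

lemma hyperbolic_lft_branch:
  fixes F :: "(nat \<Rightarrow> 'p::prime_card padic) \<Rightarrow> nat \<Rightarrow> 'p padic"
  assumes "hyperbolic_lft m F"
  obtains i s \<sigma> a b e where "hyperbolic_branch m i s \<sigma> a (b :: nat \<Rightarrow> 'p padic) e"
    "F = restrict (hyperbolic_branch.branch m i s \<sigma> a b) (D_set m)"
proof -
  obtain i \<sigma> P Q where par: "lft_param m i \<sigma> P" and F: "F = lft m i \<sigma> P Q"
    and hyp: "hyperbolic_param m i \<sigma> (\<lambda>k. of_rat (P k) :: 'p padic) (\<lambda>k. of_rat (Q k))"
    using assms unfolding hyperbolic_lft_def by blast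
  define s where "s = inv \<sigma> i"
  define a :: "nat \<Rightarrow> 'p padic" where "a = (\<lambda>k. of_rat (P k))"
  define b :: "nat \<Rightarrow> 'p padic" where "b = (\<lambda>k. of_rat (Q k))"
  define e where "e = padic_val (a s) - padic_val (b s)"
  have i: "i \<in> {1..m}" and perm: "\<sigma> permutes {1..m}" using par by (auto simp: lft_param_def)
  have s: "s \<in> {1..m}" using i permutes_in_image[OF permutes_inv[OF perm]] by (simp add: s_def)
  have hyp: "\<And>k. k \<in> {1..m} \<Longrightarrow> a k \<noteq> 0 \<and> padic_ord (a k) \<ge> 0"
    "padic_ord (b s) \<le> 0" "padic_ord (a s / b s) > 0"
    "\<And>k. k \<in> {1..m} - {s} \<Longrightarrow> padic_ord (b k) \<le> 0 \<Longrightarrow> padic_ord (a s / b s) - padic_ord (a k / b k) > 0"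
    "\<And>k. k \<in> {1..m} - {s} \<Longrightarrow> padic_ord (b k) > 0 \<Longrightarrow> padic_ord (a s / b s) - padic_ord (a k) > 0"
    using hyp unfolding hyperbolic_param_def Let_def s_def a_def b_def by auto
  have ord: "padic_ord x \<le> 0 \<longleftrightarrow> x \<noteq> 0 \<and> padic_val x \<le> 0" "0 \<le> padic_ord x \<longleftrightarrow> x = 0 \<or> 0 \<le> padic_val x"
    for x :: "'p padic"
    by (cases "x = 0"; simp add: padic_ord_eq_val)+
  have b_nz: "b s \<noteq> 0" using hyp(2) by (simp add: ord)
  have ord_s: "padic_ord (a s / b s) = ereal (of_int e)"
    using hyp(1)[OF s] b_nz by (simp add: padic_ord_eq_val padic_val_divide e_def)
  \<comment> \<open>If \<open>b k\<close> has valuation at most 0, condition (iii) gives val (a k) -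
    val (b k) < e, which is the ideal bound by integrality and implies val (a k) < e. Otherwise,
    \<open>b k = 0\<close> included, condition (iv) is val (a k) < e, so the required level is at
    most 0.\<close>
  have other: "padic_val (a k) < e \<and> b k \<in> padic_ideal (1 + padic_val (a k) - e)"
    if k: "k \<in> {1..m} - {s}" for k
  proof (cases "padic_ord (b k) \<le> 0")
    case True
    hence bk: "b k \<noteq> 0" "padic_val (b k) \<le> 0" by (simp_all add: ord)
    moreover have "padic_ord (a k / b k) = ereal (of_int (padic_val (a k) - padic_val (b k)))"
      using k hyp(1) bk by (simp add: padic_ord_eq_val padic_val_divide)
    hence "padic_val (a k) - padic_val (b k) < e"
      using hyp(4)[OF k True] ord_s by simp
    ultimately show ?thesis by (simp add: padic_ideal_iff)
  next
    case False
    hence "padic_val (a k) < e"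
      using hyp(1)[of k] hyp(5)[OF k] k ord_s by (simp add: padic_ord_eq_val)
    thus ?thesis using False by (auto simp: ord padic_ideal_iff)
  qed
  have br: "hyperbolic_branch m i s \<sigma> a b e"
  proof
    show "\<sigma> s = i" using permutes_inverses(1)[OF perm] by (simp add: s_def)
    show "e \<ge> 1" using hyp(3) unfolding ord_s by simp
  qed (use s perm hyp(1,2) b_nz other in \<open>auto simp: ord e_def\<close>)
  have "F = restrict (\<lambda>x. \<lambda>k\<in>{1..m}. if k = s then a k / x i - b k else a k * x (\<sigma> k) / x i - b k) (D_set m)"
    unfolding F lft_def s_def a_def b_def ..
  also have "\<dots> = restrict (hyperbolic_branch.branch m i s \<sigma> a b) (D_set m)"
    by (rule restrict_ext) (rule hyperbolic_branch.branch_def[OF br, symmetric])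
  finally show ?thesis by (rule that[OF br])
qed

text \<open>The equation \<open>x i = 0\<close> would itself be a nontrivial integral
  relation.\<close>

lemma D_set_component_nz:
  assumes "x \<in> D_set m" "i \<in> {1..m}"
  shows "x i \<noteq> 0"
proof
  assume xi: "x i = 0"
  define c :: "nat \<Rightarrow> int" where "c = (\<lambda>k. if k = i then 1 else 0)"
  have "(\<Sum>k=1..m. of_int (c k) * x k) = 0" by (rule sum.neutral) (simp add: c_def xi)
  moreover have "c 0 = 0" using assms(2) by (simp add: c_def)
  ultimately have "of_int (c 0) + (\<Sum>k=1..m. of_int (c k) * x k) = 0" by simp
  moreover have "\<forall>c::nat \<Rightarrow> int. of_int (c 0) + (\<Sum>k=1..m. of_int (c k) * x k) = 0 \<longrightarrow> (\<forall>k\<le>m. c k = 0)"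
    using assms(1) by (simp add: D_set_def)
  ultimately have "c i = 0" using assms(2) by simp
  thus False by (simp add: c_def)
qed

lemma (in padic_haar) hyperbolic_cylinder:
  assumes "hyperbolic_lft m F" and cyl: "cylinder m F \<subseteq> D_set' m"
  obtains K where
    "\<And>A. A \<in> sets (restrict_space (haar_prod \<mu> m) (D_set' m)) \<Longrightarrow>
      cylinder m F \<inter> F -` A \<in> sets (restrict_space (haar_prod \<mu> m) (D_set' m))"
    "\<And>A. A \<in> sets (restrict_space (haar_prod \<mu> m) (D_set' m)) \<Longrightarrow>
      emeasure (restrict_space (haar_prod \<mu> m) (D_set' m)) (cylinder m F \<inter> F -` A) =
      K * emeasure (restrict_space (haar_prod \<mu> m) (D_set' m)) A"
    "\<And>x y n. x \<in> cylinder m F \<Longrightarrow> y \<in> cylinder m F \<Longrightarrow> n \<ge> 1 \<Longrightarrow>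
      F y \<in> polyball m (F x) n \<Longrightarrow> y \<in> polyball m x (n + 1)"
proof -
  let ?M = "haar_prod \<mu> m" and ?D = "D_set' m :: (nat \<Rightarrow> 'p padic) set"
  obtain i s \<sigma> and a b :: "nat \<Rightarrow> 'p padic" and e where
    "hyperbolic_branch m i s \<sigma> a b e"
    and F: "F = restrict (hyperbolic_branch.branch m i s \<sigma> a b) (D_set m)"
    using assms(1) by (rule hyperbolic_lft_branch)
  then interpret hyperbolic_branch_haar \<mu> m i s \<sigma> a b e
    by (intro hyperbolic_branch_haar.intro padic_haar_axioms)
  have D: "?D \<subseteq> polydisc m" "?D \<subseteq> D_set m" by (auto simp: D_set'_def polydisc_def)
  have F_eq: "F x = branch x" if "x \<in> cylinder m F" for x
    using that unfolding F by (simp add: cylinder_def)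
  have eq: "cylinder m F \<inter> F -` A = ?D \<inter> pre A" if A: "A \<subseteq> ?D" for A
  proof (intro equalityI subsetI)
    fix x assume x: "x \<in> cylinder m F \<inter> F -` A"
    hence "x \<in> ?D" "x i \<noteq> 0" "branch x \<in> A"
      using cyl D_set_component_nz[of x m i] i F_eq[of x] by (auto simp: cylinder_def)
    thus "x \<in> ?D \<inter> pre A" using D by (auto simp: pre_def)
  next
    fix x assume x: "x \<in> ?D \<inter> pre A"
    hence "x \<in> D_set m" "branch x \<in> A" using D by (auto simp: pre_def)
    thus "x \<in> cylinder m F \<inter> F -` A" using A unfolding F cylinder_def by auto
  qed
  have sets: "A \<in> sets (restrict_space ?M ?D) \<longleftrightarrow> A \<subseteq> ?D \<and> A \<in> sets ?M" for A
    using D_set'_full(1) by (simp add: sets_restrict_space_iff)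
  have emeasure: "emeasure (restrict_space ?M ?D) A = emeasure ?M A" if "A \<subseteq> ?D" for A
    using that D(1) D_set'_full(1)
    by (intro emeasure_restrict_space) (simp_all add: space_haar_prod Int_absorb2)
  have null: "polydisc m - ?D \<in> null_sets ?M"
  proof (rule null_setsI)
    show "polydisc m - ?D \<in> sets ?M" using polydisc_in_sets D_set'_full(1) by (rule sets.Diff)
    show "emeasure ?M (polydisc m - ?D) = 0"
      using emeasure_Diff[of ?M ?D "polydisc m"] D_set'_full D(1) polydisc_in_sets
        prob_space.emeasure_space_1[OF prob_space_haar_prod, of m]
      by (simp add: space_haar_prod)
  qed
  show ?thesis
  proof (rule that[of scaling])
    fix A assume "A \<in> sets (restrict_space ?M ?D)"
    hence A: "A \<subseteq> ?D" "A \<in> sets ?M" by (simp_all add: sets)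
    note pre = emeasure_pre[OF A(2)]
    show "cylinder m F \<inter> F -` A \<in> sets (restrict_space ?M ?D)"
      unfolding eq[OF A(1)] sets using pre(1) D_set'_full(1) by auto
    have "?D \<inter> pre A = pre A - (polydisc m - ?D)" by (auto simp: pre_def)
    hence "emeasure ?M (?D \<inter> pre A) = emeasure ?M (pre A)"
      using emeasure_Diff_null_set[OF null pre(1)] by simp
    thus "emeasure (restrict_space ?M ?D) (cylinder m F \<inter> F -` A) =
        scaling * emeasure (restrict_space ?M ?D) A"
      using pre(2) A(1) by (simp add: eq emeasure)
  next
    fix x y n assume xy: "x \<in> cylinder m F" "y \<in> cylinder m F" and n: "(n::int) \<ge> 1"
      and yx: "F y \<in> polyball m (F x) n"
    have "x \<in> pre (polydisc m)" "y \<in> pre (polydisc m)"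
      using xy eq[of ?D] D by (auto simp: cylinder_def pre_def)
    thus "y \<in> polyball m x (n + 1)"
      using branch_expanding n yx xy by (simp add: F_eq)
  qed
qed

section \<open>Ergodicity of expanding maps\<close>

text \<open>When \<open>R\<close> means lying in a common polyball of fixed radius, these are the
  unions of such polyballs cut down to \<open>S\<close>.\<close>

definition saturated :: "'a set \<Rightarrow> ('a \<Rightarrow> 'a \<Rightarrow> bool) \<Rightarrow> 'a set \<Rightarrow> bool" where
  "saturated S R A \<longleftrightarrow> A \<subseteq> S \<and> (\<forall>x\<in>A. \<forall>y\<in>S. R x y \<longrightarrow> y \<in> A)"

text \<open>\<open>R n\<close> expresses closeness at level \<open>n\<close>. By \<open>R0\<close>
  only the empty set and the whole space are saturated at level 0, which starts the induction.
  \<open>scale\<close> covers all measurable sets because it is applied to an invariant set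
  intersected with a saturated one. \<open>gen\<close> also supplies measurability of saturated
  sets, which may be uncountable unions of classes.\<close>

lemma ergodic_measure_expanding:
  fixes R :: "nat \<Rightarrow> 'a \<Rightarrow> 'a \<Rightarrow> bool" and C :: "'l \<Rightarrow> 'a set"
  assumes "prob_space M" and \<Lambda>: "countable \<Lambda>"
    and C: "disjoint_family_on C \<Lambda>" "(\<Union>l\<in>\<Lambda>. C l) = space M"
    and T: "T \<in> space M \<rightarrow> space M"
    and sets: "\<And>l A. l \<in> \<Lambda> \<Longrightarrow> A \<in> sets M \<Longrightarrow> C l \<inter> T -` A \<in> sets M"
    and scale: "\<And>l A. l \<in> \<Lambda> \<Longrightarrow> A \<in> sets M \<Longrightarrow> emeasure M (C l \<inter> T -` A) = K l * emeasure M A"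
    and refl: "\<And>n x. x \<in> space M \<Longrightarrow> R n x x"
    and trans: "\<And>n x y z. R n x y \<Longrightarrow> R n y z \<Longrightarrow> R n x z"
    and mono: "\<And>n k x y. R k x y \<Longrightarrow> n \<le> k \<Longrightarrow> R n x y"
    and R0: "\<And>x y. x \<in> space M \<Longrightarrow> y \<in> space M \<Longrightarrow> R 0 x y"
    and expand: "\<And>l n x y. l \<in> \<Lambda> \<Longrightarrow> x \<in> C l \<Longrightarrow> y \<in> C l \<Longrightarrow> R n (T x) (T y) \<Longrightarrow> R (Suc n) x y"
    and gen: "sets M = sigma_sets (space M) {A. \<exists>n. saturated (space M) (R n) A}"
  shows "ergodic_measure M T"
proof -
  interpret prob_space M by fact
  let ?E = "{A. \<exists>n. saturated (space M) (R n) A}"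
  have sat_sets: "A \<in> sets M" if "saturated (space M) (R n) A" for n A
    unfolding gen using that by (intro sigma_sets.Basic) auto
  have C_sub: "C l \<subseteq> space M" if "l \<in> \<Lambda>" for l using that C(2) by blast
  have C_sets: "C l \<in> sets M" if "l \<in> \<Lambda>" for l
  proof -
    have "C l \<inter> T -` space M = C l" using C_sub[OF that] T by blast
    thus ?thesis using sets[OF that sets.top] by simp
  qed
  have decomp: "emeasure M A = (\<integral>\<^sup>+l. emeasure M (C l \<inter> A) \<partial>count_space \<Lambda>)" if A: "A \<in> sets M" for A
  proof -
    have "A = (\<Union>l\<in>\<Lambda>. C l \<inter> A)" using C(2) sets.sets_into_space[OF A] by blast
    moreover have "emeasure M (\<Union>l\<in>\<Lambda>. C l \<inter> A) = (\<integral>\<^sup>+l. emeasure M (C l \<inter> A) \<partial>count_space \<Lambda>)"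
    proof (rule emeasure_UN_countable[OF _ \<Lambda>])
      show "disjoint_family_on (\<lambda>l. C l \<inter> A) \<Lambda>"
        using C(1) by (auto simp: disjoint_family_on_def)
    qed (use A C_sets in auto)
    ultimately show ?thesis by simp
  qed
  have vimage: "T -` A \<inter> space M = (\<Union>l\<in>\<Lambda>. C l \<inter> T -` A)" for A using C(2) by blast
  have T_meas: "T -` A \<inter> space M \<in> sets M" if "A \<in> sets M" for A
    unfolding vimage using \<Lambda> sets that by (intro sets.countable_UN') auto
  have sum: "(\<integral>\<^sup>+l. K l * emeasure M A \<partial>count_space \<Lambda>) = emeasure M (T -` A \<inter> space M)"
    if A: "A \<in> sets M" for A
  proof -
    have "emeasure M (T -` A \<inter> space M) = (\<integral>\<^sup>+l. emeasure M (C l \<inter> (T -` A \<inter> space M)) \<partial>count_space \<Lambda>)"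
      by (rule decomp[OF T_meas[OF A]])
    also have "\<dots> = (\<integral>\<^sup>+l. K l * emeasure M A \<partial>count_space \<Lambda>)"
    proof (rule nn_integral_cong)
      fix l assume "l \<in> space (count_space \<Lambda>)"
      hence l: "l \<in> \<Lambda>" by simp
      have "C l \<inter> (T -` A \<inter> space M) = C l \<inter> T -` A" using C_sub[OF l] by blast
      thus "emeasure M (C l \<inter> (T -` A \<inter> space M)) = K l * emeasure M A" using scale[OF l A] by simp
    qed
    finally show ?thesis by simp
  qed
  \<comment> \<open>The individual constants are never summed: the whole space is its own preimage
    and has measure 1.\<close>
  have K: "(\<integral>\<^sup>+l. K l \<partial>count_space \<Lambda>) = 1"
  proof -
    have "T -` space M \<inter> space M = space M" using T by blast
    thus ?thesis using sum[OF sets.top] by (simp add: emeasure_space_1)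
  qed
  have invariant: "emeasure M (T -` A \<inter> space M) = emeasure M A" if "A \<in> sets M" for A
    using sum[OF that] K by (simp add: nn_integral_multc)
  have zero_one: "emeasure M X = 0 \<or> emeasure M X = 1"
    if X: "X \<in> sets M" and inv: "X = T -` X \<inter> space M" for X
  proof -
    have indep: "emeasure M (X \<inter> A) = emeasure M X * emeasure M A"
      if "saturated (space M) (R n) A" for n A
      using that
    proof (induction n arbitrary: A)
      case (0 A)
      have "A = {} \<or> A = space M" using 0 R0 unfolding saturated_def by blast
      thus ?case using sets.sets_into_space[OF X] by (auto simp: emeasure_space_1 Int_absorb2)
    next
      case (Suc n A)
      have A: "A \<in> sets M" using Suc.prems by (rule sat_sets)
      \<comment> \<open>The saturation of the image of \<open>C l \<inter> A\<close> at level
        \<open>n\<close>. Pulling it back adds nothing inside \<open>C l\<close>, since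
        \<open>expand\<close> lifts closeness of images to level \<open>Suc n\<close>, at which
        \<open>A\<close> is saturated.\<close>
      define B where "B = (\<lambda>l. {y \<in> space M. \<exists>x\<in>C l \<inter> A. R n (T x) y})"
      have B: "saturated (space M) (R n) (B l)" for l
        unfolding saturated_def B_def using trans by blast
      have CA: "C l \<inter> A = C l \<inter> T -` B l" if l: "l \<in> \<Lambda>" for l
      proof (intro equalityI subsetI)
        fix x assume x: "x \<in> C l \<inter> A"
        hence "T x \<in> space M" using C_sub[OF l] T by blast
        thus "x \<in> C l \<inter> T -` B l" using x refl unfolding B_def by blast
      next
        fix y assume y: "y \<in> C l \<inter> T -` B l"
        then obtain x where x: "x \<in> C l \<inter> A" "R n (T x) (T y)" by (auto simp: B_def)
        hence "R (Suc n) x y" using expand[OF l] y by blast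
        thus "y \<in> C l \<inter> A" using Suc.prems x y C_sub[OF l] unfolding saturated_def by blast
      qed
      have "emeasure M (X \<inter> A) = (\<integral>\<^sup>+l. emeasure M (C l \<inter> (X \<inter> A)) \<partial>count_space \<Lambda>)"
        using X A by (intro decomp) auto
      also have "\<dots> = (\<integral>\<^sup>+l. emeasure M X * emeasure M (C l \<inter> A) \<partial>count_space \<Lambda>)"
      proof (rule nn_integral_cong)
        fix l assume "l \<in> space (count_space \<Lambda>)"
        hence l: "l \<in> \<Lambda>" by simp
        \<comment> \<open>Invariance lets \<open>X\<close> be pulled back through the same branch as
          \<open>B l\<close>. The factor \<open>K l\<close> then appears both with and without
          \<open>X\<close>, and the induction hypothesis at level \<open>n\<close> applies to
          \<open>B l\<close>.\<close>
        have "C l \<inter> X = C l \<inter> T -` X" using inv C_sub[OF l] by blast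
        hence "C l \<inter> (X \<inter> A) = C l \<inter> T -` (X \<inter> B l)" using CA[OF l] by blast
        also have "emeasure M \<dots> = K l * emeasure M (X \<inter> B l)"
          using X sat_sets[OF B] by (intro scale[OF l]) auto
        also have "\<dots> = emeasure M X * (K l * emeasure M (B l))"
          unfolding Suc.IH[OF B] by (simp only: mult_ac)
        also have "K l * emeasure M (B l) = emeasure M (C l \<inter> A)"
          unfolding CA[OF l] by (rule scale[OF l sat_sets[OF B], symmetric])
        finally show "emeasure M (C l \<inter> (X \<inter> A)) = emeasure M X * emeasure M (C l \<inter> A)" .
      qed
      also have "\<dots> = emeasure M X * emeasure M A"
        unfolding decomp[OF A] by (rule nn_integral_cmult) simp
      finally show ?case .
    qed
    have stable: "Int_stable ?E"
    proof (rule Int_stableI, clarify)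
      fix A B n k assume "saturated (space M) (R n) A" "saturated (space M) (R k) B"
      hence "saturated (space M) (R (max n k)) (A \<inter> B)"
        using mono[OF _ max.cobounded1] mono[OF _ max.cobounded2] unfolding saturated_def by blast
      thus "\<exists>n. saturated (space M) (R n) (A \<inter> B)" by blast
    qed
    have top: "saturated (space M) (R 0) (space M)" by (simp add: saturated_def)
    \<comment> \<open>Two finite measures, A \<mapsto> \<mu>(X \<inter> A) and A \<mapsto> \<mu>(X)
      \<mu>(A), agree on an intersection-stable generator. The whole space belongs to it, so a
      constant exhausting sequence suffices.\<close>
    have "density M (indicator X) = scale_measure (emeasure M X) M"
    proof (rule measure_eqI_generator_eq[OF stable, where \<Omega> = "space M" and A = "\<lambda>_. space M"])
      show "?E \<subseteq> Pow (space M)" by (auto simp: saturated_def)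
      fix A assume "A \<in> ?E"
      then obtain n where n: "saturated (space M) (R n) A" by blast
      thus "emeasure (density M (indicator X)) A = emeasure (scale_measure (emeasure M X) M) A"
        using indep[OF n] sat_sets[OF n] X by (simp add: emeasure_density flip: indicator_inter_arith)
    next
      show "emeasure (density M (indicator X)) (space M) \<noteq> \<infinity>"
        using X by (simp add: emeasure_density Int_absorb2 sets.sets_into_space flip: indicator_inter_arith)
    qed (use gen top in auto)
    hence "emeasure (density M (indicator X)) X = emeasure (scale_measure (emeasure M X) M) X" by simp
    hence sq: "emeasure M X = emeasure M X * emeasure M X"
      using X by (simp add: emeasure_density flip: indicator_inter_arith)
    hence "measure M X = measure M X * measure M X"
      unfolding emeasure_eq_measure by (simp flip: ennreal_mult)
    hence "measure M X = 0 \<or> measure M X = 1" by simp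
    thus ?thesis unfolding emeasure_eq_measure by auto
  qed
  show ?thesis
    unfolding ergodic_measure_def
    using invariant zero_one T T_meas prob_space_axioms by (auto simp: measurable_def)
qed

section \<open>Ergodicity of continued fraction systems\<close>

theorem theorem5p7:
  fixes m :: nat
    and \<mu> :: "'p::prime_card padic measure"
    and \<Lambda> :: "'l set"
    and F :: "'l \<Rightarrow> (nat \<Rightarrow> 'p padic) \<Rightarrow> nat \<Rightarrow> 'p padic"
  assumes "m \<ge> 1"
    and "normalized_haar \<mu>"
    and "cf_system m \<Lambda> F"
  shows "ergodic_measure (restrict_space (haar_prod \<mu> m) (D_set' m)) (cf_map m \<Lambda> F)"
proof -
  interpret padic_haar \<mu> using assms(2) by (rule padic_haar.intro)
  let ?D = "D_set' m :: (nat \<Rightarrow> 'p padic) set" and ?T = "cf_map m \<Lambda> F"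
  let ?M = "restrict_space (haar_prod \<mu> m) ?D"
  define C where "C = (\<lambda>l. cylinder m (F l))"
  \<comment> \<open>The shift by 1 makes \<open>R 0\<close> total: the polydisc is the polyball of
    level 1 around each of its points.\<close>
  define R where "R = (\<lambda>n x y. y \<in> polyball m (x :: nat \<Rightarrow> 'p padic) (int n + 1))"
  have \<Lambda>: "countable \<Lambda>" and hyp: "\<And>l. l \<in> \<Lambda> \<Longrightarrow> hyperbolic_lft m (F l)"
    and disj: "disjoint_family_on C \<Lambda>" and cover: "(\<Union>l\<in>\<Lambda>. C l) = ?D"
    using assms(3) by (auto simp: cf_system_def C_def)
  have D_sub: "?D \<subseteq> polydisc m" by (auto simp: D_set'_def polydisc_def)
  have space: "space ?M = ?D"
    using D_sub by (auto simp: space_restrict_space space_haar_prod)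
  have C_sub: "cylinder m (F l) \<subseteq> ?D" if "l \<in> \<Lambda>" for l using that cover by (auto simp: C_def)
  have T: "?T x = F l x" if "l \<in> \<Lambda>" "x \<in> C l" for l x
  proof -
    have "(THE l. l \<in> \<Lambda> \<and> x \<in> cylinder m (F l)) = l"
      using that disj by (intro the_equality) (auto simp: C_def disjoint_family_on_def)
    moreover have "x \<in> ?D" using that cover by blast
    ultimately show ?thesis by (simp add: cf_map_def)
  qed
  have vimage: "C l \<inter> ?T -` A = cylinder m (F l) \<inter> F l -` A" if "l \<in> \<Lambda>" for l A
    using T[OF that] by (auto simp: C_def)
  have "\<forall>l\<in>\<Lambda>. \<exists>K. \<forall>A\<in>sets ?M. emeasure ?M (C l \<inter> ?T -` A) = K * emeasure ?M A"
    using hyperbolic_cylinder[OF hyp C_sub] vimage by metis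
  then obtain K where K: "\<And>l A. l \<in> \<Lambda> \<Longrightarrow> A \<in> sets ?M \<Longrightarrow>
      emeasure ?M (C l \<inter> ?T -` A) = K l * emeasure ?M A" by metis
  have gen: "sets ?M = sigma_sets (space ?M) {A. \<exists>n. saturated (space ?M) (R n) A}"
  proof
    have "sets ?M = sigma_sets ?D ((\<inter>) ?D ` polyballs m)"
      using D_set'_full(1)[of m] D_sub unfolding sets_restrict_space sets_haar_prod
      by (rule sigma_sets_Int)
    also have "\<dots> \<subseteq> sigma_sets ?D {A. \<exists>n. saturated ?D (R n) A}"
    proof (rule sigma_sets_mono', clarify)
      fix B :: "(nat \<Rightarrow> 'p padic) set" assume B: "B \<in> polyballs m"
      show "\<exists>n. saturated ?D (R n) (?D \<inter> B)"
      proof (cases "B = {}")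
        case True
        thus ?thesis by (simp add: saturated_def)
      next
        case False
        then obtain c n where B: "B = polyball m c n" "n \<ge> 1" using B by (auto simp: polyballs_def)
        \<comment> \<open>The level n - 1 undoes the shift in \<open>R\<close> and is a natural
          number because n \<ge> 1.\<close>
        have "saturated ?D (R (nat (n - 1))) (?D \<inter> B)"
          using polyball_recenter B by (fastforce simp: saturated_def R_def)
        thus ?thesis ..
      qed
    qed
    finally show "sets ?M \<subseteq> sigma_sets (space ?M) {A. \<exists>n. saturated (space ?M) (R n) A}"
      unfolding space .
    have "A \<in> sets ?M" if sat: "saturated ?D (R n) A" for A n
    proof -
      \<comment> \<open>\<open>A\<close> may need uncountably many polyballs, but their union is
        \<open>polyopen\<close> and so measurable. Saturation ensures that its trace on
        \<open>?D\<close> is \<open>A\<close> again.\<close>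
      let ?U = "\<Union>x\<in>A. polyball m x (int n + 1)"
      have A: "A \<subseteq> ?D" using sat by (simp add: saturated_def)
      have "polyopen m ?U"
        unfolding polyopen_def
      proof (intro conjI ballI)
        show "?U \<subseteq> polydisc m" using A D_sub polyball_subset_polydisc[of _ m "int n + 1"] by force
        fix y assume "y \<in> ?U"
        then obtain x where "x \<in> A" "polyball m x (int n + 1) = polyball m y (int n + 1)"
          using polyball_recenter by blast
        thus "\<exists>n. polyball m y n \<subseteq> ?U" by blast
      qed
      hence "?D \<inter> ?U \<in> sets ?M"
        using polyopen_in_sets by (auto simp: sets_restrict_space)
      moreover have "?D \<inter> ?U = A"
        using sat polyball_center[of _ m "int n + 1"] A D_sub unfolding saturated_def R_def by blast
      ultimately show ?thesis by simp
    qed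
    thus "sigma_sets (space ?M) {A. \<exists>n. saturated (space ?M) (R n) A} \<subseteq> sets ?M"
      by (intro sets.sigma_sets_subset) (auto simp: space)
  qed
  show ?thesis
  proof (rule ergodic_measure_expanding[OF _ \<Lambda> disj _ _ _ K _ _ _ _ _ gen])
    show "prob_space ?M"
      using D_set'_full[of m] D_sub
      by (intro prob_spaceI) (simp add: space emeasure_restrict_space space_haar_prod Int_absorb2)
    show "(\<Union>l\<in>\<Lambda>. C l) = space ?M" using cover space by simp
    show "?T \<in> space ?M \<rightarrow> space ?M"
    proof
      fix x assume "x \<in> space ?M"
      then obtain l where l: "l \<in> \<Lambda>" "x \<in> C l" using cover unfolding space by blast
      thus "?T x \<in> space ?M" using T[OF l] by (simp add: space C_def cylinder_def)
    qed
    show "C l \<inter> ?T -` A \<in> sets ?M" if "l \<in> \<Lambda>" "A \<in> sets ?M" for l A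
      unfolding vimage[OF that(1)]
      by (rule hyperbolic_cylinder[OF hyp[OF that(1)] C_sub[OF that(1)]]) (use that(2) in blast)
    show "R (Suc n) x y" if "l \<in> \<Lambda>" "x \<in> C l" "y \<in> C l" "R n (?T x) (?T y)" for l n x y
    proof (rule hyperbolic_cylinder[OF hyp[OF that(1)] C_sub[OF that(1)]])
      assume "\<And>x y n. x \<in> cylinder m (F l) \<Longrightarrow> y \<in> cylinder m (F l) \<Longrightarrow> n \<ge> 1 \<Longrightarrow>
        F l y \<in> polyball m (F l x) n \<Longrightarrow> y \<in> polyball m x (n + 1)"
      from this[of x y "int n + 1"] show ?thesis
        using that T[OF that(1)] by (simp add: R_def C_def add.commute)
    qed
    show "R n x x" if "x \<in> space ?M" for n x
      using that D_sub polyball_center unfolding R_def space by blast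
    show "R n x z" if "R n x y" "R n y z" for n x y z
      using that polyball_recenter unfolding R_def by blast
    show "R n x y" if "R k x y" "n \<le> k" for n k x y
      using that polyball_antimono[of "int n + 1" "int k + 1" m x] unfolding R_def by auto
    show "R 0 x y" if "x \<in> space ?M" "y \<in> space ?M" for x y
      using that D_sub polydisc_eq_polyball[of x m] by (auto simp: R_def space)
  qed
qed

end
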